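(* Assume that $F:\mathbb{R}^n\rightrightarrows\mathbb{R}^m$ is strictly proto-differentiable at $\bar x$ for $\bar y\in F(\bar x)$ and assume that $\mathrm{gph}\,F$ is locally closed at $(\bar x,\bar y)$. Then the following statements are equivalent: (i) $F$ is strongly metrically regular around $(\bar x,\bar y)$. (ii) $F$ is graphically Lipschitzian of dimension $m$ around $(\bar x,\bar y)$ and metrically regular around $(\bar x,\bar y)$. (iii) $F$ is graphically Lipschitzian of dimension $m$ around $(\bar x,\bar y)$ and strongly metrically subregular at $(\bar x,\bar y)$. (iv) There is an $n\times m$ matrix $C$ such that $\mathrm{gph}\,D^*F(\bar x,\bar y)=\mathrm{rge}(C^T,I_n)$. (v) There is an $n\times m$ matrix $C$ such that $\mathrm{gph}\,DF(\bar x,\bar y)=\mathrm{rge}(C,I_m)$. In every case $F^{-1}$ has a single-valued localization around $(\bar y,\bar x)$ which is strictly differentiable at $\bar y$.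
   Context: $\mathrm{gph}\,F=\{(x,y)\mid y\in F(x)\}$. For matrices $A\in\mathbb{R}^{p\times k}$, $B\in\mathbb{R}^{q\times k}$, $\mathrm{rge}(A,B)=\{(Av,Bv)\mid v\in\mathbb{R}^k\}\subset\mathbb{R}^p\times\mathbb{R}^q$. Set limits are in the Painlevé–Kuratowski sense: $\limsup_{t\to\bar t}C_t=\{x\mid\liminf_{t\to\bar t}\mathrm{dist}(x,C_t)=0\}$, $\liminf_{t\to\bar t}C_t=\{x\mid\limsup_{t\to\bar t}\mathrm{dist}(x,C_t)=0\}$; the limit exists if both coincide. $A^\circ=\{v\mid\langle v,a\rangle\le0\ \forall a\in A\}$. For $\Omega\subset\mathbb{R}^N$ and $\bar z\in\Omega$: $T_\Omega(\bar z)=\limsup_{t\downarrow0}\frac{\Omega-\bar z}{t}$, $\widehat N_\Omega(\bar z)=(T_\Omega(\bar z))^\circ$, $N_\Omega(\bar z)=\limsup_{z\to\bar z,\,z\in\Omega}\widehat N_\Omega(z)$. $F$ is strictly proto-differentiable at $\bar x$ for $\bar y$ if $\mathrm{gph}\,F$ is strictly smooth at $(\bar x,\bar y)$, i.e. the set limit of $\frac{\mathrm{gph}\,F-(x,y)}{t}$ exists as $(x,y)\to(\bar x,\bar y)$ with $(x,y)\in\mathrm{gph}\,F$ and $t\downarrow0$. The graphical derivative and limiting coderivative are given by $\mathrm{gph}\,DF(\bar x,\bar y)=T_{\mathrm{gph}\,F}(\bar x,\bar y)$ and $\mathrm{gph}\,D^*F(\bar x,\bar y)=\{(y^*,x^*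 )\in\mathbb{R}^m\times\mathbb{R}^n\mid(x^*,-y^* )\in N_{\mathrm{gph}\,F}(\bar x,\bar y)\}$. $F$ is graphically Lipschitzian of dimension $d$ around $(\bar x,\bar y)$ if there is an open neighborhood $W$ of $(\bar x,\bar y)$ and a one-to-one mapping $\Phi$ from $W$ onto an open subset of $\mathbb{R}^{n+m}$, with $\Phi,\Phi^{-1}$ continuously differentiable, such that $\Phi(\mathrm{gph}\,F\cap W)$ is the graph of a Lipschitz continuous mapping $f:U\to\mathbb{R}^{n+m-d}$, $U$ open in $\mathbb{R}^d$. $F$ is strongly metrically subregular at $(\bar x,\bar y)\in\mathrm{gph}\,F$ if there are $\kappa\ge0$ and a neighborhood $U$ of $\bar x$ with $\|x-\bar x\|\le\kappa\,\mathrm{dist}(\bar y,F(x))$ for all $x\in U$. $F$ is metrically regular around $(\bar x,\bar y)$ if there are $\kappa\ge0$ and neighborhoods $U$ of $\bar x$, $V$ of $\bar y$ with $\mathrm{dist}(x,F^{-1}(y))\le\kappa\,\mathrm{dist}(y,F(x))$ for all $(x,y)\in U\times V$. ($\mathrm{dist}(\cdot,\emptyset)=\infty$.) $F^{-1}$ has a single-valued localization around $(\bar y,\bar x)$ if there are open neighborhoods $V'$ of $\bar y$, $U'$ of $\bar x$ and a mapping $h:V'\to\mathbb{R}^n$ with $h(\bar y)=\bar x$ such that $\mathrm{gph}\,F\cap(U'\times V')=\{(h(y),y)\mid y\in V'\}$; $h$ is the localization. $F$ is strongly metrically regular around $(\bar x,\bar y)$ if it is metrically regular around $(\bar x,\bar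 y)$ and $F^{-1}$ has a single-valued localization around $(\bar y,\bar x)$. A mapping $h$ is strictly differentiable at $\bar y$ if there is a matrix $A$ with $\lim_{y,y'\to\bar y,\,y\neq y'}\frac{h(y')-h(y)-A(y'-y)}{\|y'-y\|}=0$. *)

theory Defs
  imports "HOL-Analysis.Analysis"
begin

section \<open>Set-valued maps\<close>

definition gph :: "('a \<Rightarrow> 'b set) \<Rightarrow> ('a \<times> 'b) set"
  where "gph F = {(x, y). y \<in> F x}"

definition inv_map :: "('a \<Rightarrow> 'b set) \<Rightarrow> 'b \<Rightarrow> 'a set"
  where "inv_map F y = {x. y \<in> F x}"

definition rge :: "real^'k^'p \<Rightarrow> real^'k^'q \<Rightarrow> ((real^'p) \<times> (real^'q)) set"
  where "rge A B = {(A *v v, B *v v) | v. True}"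


section \<open>Painleve--Kuratowski set limits\<close>

text \<open>Distance to a set with value \<open>\<infinity>\<close> for the empty set (the library's \<^const>\<open>infdist\<close>
  is \<open>0\<close> there).\<close>

definition edist_set :: "'a::metric_space \<Rightarrow> 'a set \<Rightarrow> ereal"
  where "edist_set x C = (INF c\<in>C. ereal (dist x c))"

definition set_limsup :: "'t filter \<Rightarrow> ('t \<Rightarrow> 'a::metric_space set) \<Rightarrow> 'a set"
  where "set_limsup \<F> C = {x. Liminf \<F> (\<lambda>t. edist_set x (C t)) = 0}"

definition set_liminf :: "'t filter \<Rightarrow> ('t \<Rightarrow> 'a::metric_space set) \<Rightarrow> 'a set"
  where "set_liminf \<F> C = {x. Limsup \<F> (\<lambda>t. edist_set x (C t)) = 0}"

definition set_limit_exists :: "'t filter \<Rightarrow> ('t \<Rightarrow> 'a::metric_space set) \<Rightarrow> bool"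
  where "set_limit_exists \<F> C \<longleftrightarrow> set_limsup \<F> C = set_liminf \<F> C"

text \<open>The filter of \<open>z' \<rightarrow> z\<close> with \<open>z' \<in> \<Omega>\<close>. As usual in variational analysis \<open>z' = z\<close> is
  allowed, which is why this is not \<open>at z within \<Omega>\<close>.\<close>

definition nhds_in :: "'a::topological_space \<Rightarrow> 'a set \<Rightarrow> 'a filter"
  where "nhds_in z \<Omega> = inf (nhds z) (principal \<Omega>)"

definition diff_quotient_set :: "'a::real_normed_vector set \<Rightarrow> 'a \<Rightarrow> real \<Rightarrow> 'a set"
  where "diff_quotient_set \<Omega> z t = (\<lambda>w. (w - z) /\<^sub>R t) ` \<Omega>"


section \<open>Tangent and normal cones\<close>

definition polar_cone :: "'a::real_inner set \<Rightarrow> 'a set"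
  where "polar_cone A = {v. \<forall>a\<in>A. v \<bullet> a \<le> 0}"

definition tangent_cone :: "'a::real_normed_vector set \<Rightarrow> 'a \<Rightarrow> 'a set"
  where "tangent_cone \<Omega> z = set_limsup (at_right 0) (diff_quotient_set \<Omega> z)"

definition regular_normal_cone :: "'a::real_inner set \<Rightarrow> 'a \<Rightarrow> 'a set"
  where "regular_normal_cone \<Omega> z = polar_cone (tangent_cone \<Omega> z)"

definition limiting_normal_cone :: "'a::real_inner set \<Rightarrow> 'a \<Rightarrow> 'a set"
  where "limiting_normal_cone \<Omega> z = set_limsup (nhds_in z \<Omega>) (regular_normal_cone \<Omega>)"

definition strictly_smooth_at :: "'a::real_normed_vector set \<Rightarrow> 'a \<Rightarrow> bool"
  where "strictly_smooth_at \<Omega> z \<longleftrightarrow>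
    set_limit_exists (nhds_in z \<Omega> \<times>\<^sub>F at_right 0) (\<lambda>(z', t). diff_quotient_set \<Omega> z' t)"

definition locally_closed_at :: "'a::topological_space set \<Rightarrow> 'a \<Rightarrow> bool"
  where "locally_closed_at \<Omega> z \<longleftrightarrow> (\<exists>V. z \<in> interior V \<and> closed V \<and> closed (\<Omega> \<inter> V))"


section \<open>Generalized derivatives of set-valued maps\<close>

definition strictly_proto_differentiable ::
    "('a::real_normed_vector \<Rightarrow> 'b::real_normed_vector set) \<Rightarrow> 'a \<Rightarrow> 'b \<Rightarrow> bool"
  where "strictly_proto_differentiable F xb yb \<longleftrightarrow> strictly_smooth_at (gph F) (xb, yb)"

definition graphical_derivative ::
    "('a::real_normed_vector \<Rightarrow> 'b::real_normed_vector set) \<Rightarrow> 'a \<Rightarrow> 'b \<Rightarrow> 'a \<Rightarrow> 'b set"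
  where "graphical_derivative F xb yb u = {v. (u, v) \<in> tangent_cone (gph F) (xb, yb)}"

definition limiting_coderivative ::
    "('a::real_inner \<Rightarrow> 'b::real_inner set) \<Rightarrow> 'a \<Rightarrow> 'b \<Rightarrow> 'b \<Rightarrow> 'a set"
  where "limiting_coderivative F xb yb ys =
    {xs. (xs, - ys) \<in> limiting_normal_cone (gph F) (xb, yb)}"


section \<open>Graphically Lipschitzian maps\<close>

definition C1_on :: "'a::real_normed_vector set \<Rightarrow> ('a \<Rightarrow> 'b::real_normed_vector) \<Rightarrow> bool"
  where "C1_on W f \<longleftrightarrow>
    (\<exists>f' :: 'a \<Rightarrow> 'a \<Rightarrow>\<^sub>L 'b.
      (\<forall>z\<in>W. (f has_derivative blinfun_apply (f' z)) (at z)) \<and> continuous_on W f')"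

text \<open>Dimensions are types, so the dimension \<open>d\<close> is passed as an index type \<open>'d\<close> with
  \<open>CARD('d) = d\<close>, together with an index type \<open>'e\<close> of cardinality \<open>n + m - d\<close>; the space
  \<open>\<real>\<^sup>n\<^sup>+\<^sup>m\<close> containing the graph of \<open>f\<close> is \<open>\<real>\<^sup>d \<times> \<real>\<^sup>n\<^sup>+\<^sup>m\<^sup>-\<^sup>d\<close>.\<close>

definition graphically_Lipschitzian ::
    "'d::finite itself \<Rightarrow> 'e::finite itself \<Rightarrow>
     (real^'n::finite \<Rightarrow> (real^'m::finite) set) \<Rightarrow> real^'n \<Rightarrow> real^'m \<Rightarrow> bool"
  where "graphically_Lipschitzian (_ :: 'd itself) (_ :: 'e itself) F xb yb \<longleftrightarrow>
    CARD('d) + CARD('e) = CARD('n) + CARD('m) \<and>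
    (\<exists>W (\<Phi> :: (real^'n) \<times> (real^'m) \<Rightarrow> (real^'d) \<times> (real^'e)).
      open W \<and> (xb, yb) \<in> W \<and>
      inj_on \<Phi> W \<and> open (\<Phi> ` W) \<and>
      C1_on W \<Phi> \<and> C1_on (\<Phi> ` W) (inv_into W \<Phi>) \<and>
      (\<exists>U (f :: real^'d \<Rightarrow> real^'e) L.
        open U \<and> L-lipschitz_on U f \<and> \<Phi> ` (gph F \<inter> W) = {(u, f u) | u. u \<in> U}))"


section \<open>Regularity properties\<close>

text \<open>In \<^typ>\<open>ereal\<close> one has \<open>0 * \<infinity> = 0\<close>. This does not matter below, since the constant
  \<open>\<kappa>\<close> may always be enlarged to a positive one.\<close>

definition strongly_metrically_subregular ::
    "('a::real_normed_vector \<Rightarrow> 'b::metric_space set) \<Rightarrow> 'a \<Rightarrow> 'b \<Rightarrow> bool"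
  where "strongly_metrically_subregular F xb yb \<longleftrightarrow>
    (\<exists>\<kappa>\<ge>0. \<exists>U. open U \<and> xb \<in> U \<and>
      (\<forall>x\<in>U. ereal (norm (x - xb)) \<le> ereal \<kappa> * edist_set yb (F x)))"

definition metrically_regular ::
    "('a::metric_space \<Rightarrow> 'b::metric_space set) \<Rightarrow> 'a \<Rightarrow> 'b \<Rightarrow> bool"
  where "metrically_regular F xb yb \<longleftrightarrow>
    (\<exists>\<kappa>\<ge>0. \<exists>U V. open U \<and> xb \<in> U \<and> open V \<and> yb \<in> V \<and>
      (\<forall>x\<in>U. \<forall>y\<in>V. edist_set x (inv_map F y) \<le> ereal \<kappa> * edist_set y (F x)))"

text \<open>\<open>h\<close> is a single-valued localization of the inverse of \<open>F\<close> around \<open>(yb, xb)\<close>; only the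
  values of \<open>h\<close> on \<open>V\<close> are relevant.\<close>

definition inverse_localization ::
    "('a::topological_space \<Rightarrow> 'b::topological_space set) \<Rightarrow> 'a \<Rightarrow> 'b \<Rightarrow> ('b \<Rightarrow> 'a) \<Rightarrow> bool"
  where "inverse_localization F xb yb h \<longleftrightarrow>
    (\<exists>V U. open V \<and> yb \<in> V \<and> open U \<and> xb \<in> U \<and> h yb = xb \<and>
      gph F \<inter> (U \<times> V) = {(h y, y) | y. y \<in> V})"

definition strongly_metrically_regular ::
    "('a::metric_space \<Rightarrow> 'b::metric_space set) \<Rightarrow> 'a \<Rightarrow> 'b \<Rightarrow> bool"
  where "strongly_metrically_regular F xb yb \<longleftrightarrow>
    metrically_regular F xb yb \<and> (\<exists>h. inverse_localization F xb yb h)"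

definition strictly_differentiable_at :: "(real^'m \<Rightarrow> real^'n) \<Rightarrow> real^'m \<Rightarrow> bool"
  where "strictly_differentiable_at h yb \<longleftrightarrow>
    (\<exists>A :: real^'m^'n.
      ((\<lambda>(y, y'). (h y' - h y - A *v (y' - y)) /\<^sub>R norm (y' - y)) \<longlongrightarrow> 0)
        (at (yb, yb) within {(y, y'). y \<noteq> y'}))"

end

theory Submission imports Defs begin

text \<open>Write \<open>K\<close> for the tangent cone of \<open>gph F\<close> at \<open>(xb, yb)\<close>. Strict smoothness says that tangent
  directions are stable under moving the base point, and this makes \<open>K\<close> a linear subspace
  (\<open>subspace_tangent_cone\<close>). The limiting normal cone is then the orthogonal complement of \<open>K\<close>
  (\<open>limiting_normal_cone_strictly_smooth\<close>). So the conditions on the graphical derivative and on the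
  coderivative are dual to each other (\<open>coderivative_rge_iff\<close>), and both say that \<open>K\<close> is the graph of
  a linear map \<open>C\<close> over the space of \<open>y\<close>.

  Each regularity condition has a consequence for the projection \<open>snd\<close> from \<open>K\<close>
  to \<open>\<real>\<^sup>m\<close>. Metric regularity makes it surjective (\<open>metrically_regular_tangent_onto\<close>), strong metric
  subregularity makes it injective (\<open>strongly_metrically_subregular_tangent_bound\<close>), and the
  graphical Lipschitz property of dimension \<open>m\<close> gives \<open>dim K = m\<close>
  (\<open>dim_tangent_cone_graphically_Lipschitzian\<close>). Strong metric regularity gives surjectivity and
  injectivity; the two mixed conditions give one of them together with the dimension. In all cases
  the projection is bijective and \<open>K\<close> is the graph of a linear map (\<open>subspace_eq_rge\<close>).

  Conversely let \<open>K\<close> be the graph of \<open>C\<close>. Secants of \<open>gph F\<close> near the reference point are uniformly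
  close to \<open>K\<close> by compactness (\<open>strictly_smooth_annihilator_small\<close>). Hence near \<open>(xb, yb)\<close> the point
  \<open>x\<close> is a Lipschitz function \<open>h\<close> of \<open>y\<close>, with strict derivative \<open>C\<close>. That \<open>h\<close> is defined on a whole
  neighborhood of \<open>yb\<close> is where local closedness enters: a nearest graph point exists, and if its
  second component missed the target \<open>y\<close>, a further step along \<open>K\<close> would come closer
  (\<open>strictly_smooth_covers\<close>, \<open>strictly_smooth_localization\<close>). A Lipschitz localization of the
  inverse yields all the regularity properties.\<close>

section \<open>Set limits and tangent vectors\<close>

lemma edist_set_less_iff: "edist_set x C < ereal e \<longleftrightarrow> (\<exists>c\<in>C. dist x c < e)"
  by (simp add: edist_set_def INF_less_iff)

lemma edist_set_nonneg: "0 \<le> edist_set x C"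
  unfolding edist_set_def by (intro INF_greatest) simp

text \<open>The condition \<open>Liminf = 0\<close> on distances says that points of the moving set come arbitrarily
  close frequently; for the inner limit, eventually. Distances are nonnegative, so only the upper
  estimate has content. A trivial filter would break the inner limit, because there the \<open>Limsup\<close> is
  \<open>-\<infinity>\<close>.\<close>

lemma mem_set_limsup_iff:
  "x \<in> set_limsup \<F> C \<longleftrightarrow> (\<forall>e>0. \<exists>\<^sub>F t in \<F>. \<exists>c\<in>C t. dist x c < e)"
proof -
  let ?L = "Liminf \<F> (\<lambda>t. edist_set x (C t))"
  have "?L = 0 \<longleftrightarrow> (\<forall>e>0. \<exists>\<^sub>F t in \<F>. edist_set x (C t) < ereal e)"
  proof (intro iffI allI impI)
    fix e :: real assume "?L = 0" "e > 0"
    show "\<exists>\<^sub>F t in \<F>. edist_set x (C t) < ereal e"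
    proof (rule ccontr)
      assume "\<not> ?thesis"
      then have "eventually (\<lambda>t. ereal e \<le> edist_set x (C t)) \<F>"
        by (simp add: not_frequently not_less)
      then have "ereal e \<le> ?L" by (rule Liminf_bounded)
      with \<open>?L = 0\<close> \<open>e > 0\<close> show False by simp
    qed
  next
    assume freq: "\<forall>e>0. \<exists>\<^sub>F t in \<F>. edist_set x (C t) < ereal e"
    have "?L \<le> 0"
    proof (rule ccontr)
      assume "\<not> ?L \<le> 0"
      then obtain r where r: "0 < ereal r" "ereal r < ?L"
        using ereal_dense2[of 0 ?L] by (auto simp: not_le)
      then have "\<forall>\<^sub>F t in \<F>. ereal r < edist_set x (C t)" by (intro less_LiminfD)
      then have "\<forall>\<^sub>F t in \<F>. \<not> edist_set x (C t) < ereal r"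
        by (rule eventually_mono) (simp add: not_less)
      then show False using freq r by (simp add: frequently_def)
    qed
    moreover have "0 \<le> ?L"
      by (intro Liminf_bounded always_eventually allI edist_set_nonneg)
    ultimately show "?L = 0" by (rule antisym)
  qed
  then show ?thesis
    by (simp add: set_limsup_def edist_set_less_iff)
qed

lemma mem_set_liminf_iff:
  assumes "\<F> \<noteq> bot"
  shows "x \<in> set_liminf \<F> C \<longleftrightarrow> (\<forall>e>0. \<forall>\<^sub>F t in \<F>. \<exists>c\<in>C t. dist x c < e)"
proof -
  let ?L = "Limsup \<F> (\<lambda>t. edist_set x (C t))"
  have "?L = 0 \<longleftrightarrow> (\<forall>e>0. \<forall>\<^sub>F t in \<F>. edist_set x (C t) < ereal e)"
  proof (intro iffI allI impI)
    fix e :: real assume "?L = 0" "e > 0"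
    then show "\<forall>\<^sub>F t in \<F>. edist_set x (C t) < ereal e"
      by (intro Limsup_lessD) simp
  next
    assume ev: "\<forall>e>0. \<forall>\<^sub>F t in \<F>. edist_set x (C t) < ereal e"
    have "?L \<le> 0"
    proof (rule ereal_le_epsilon2)
      fix e :: real assume "e > 0"
      with ev have "\<forall>\<^sub>F t in \<F>. edist_set x (C t) < ereal e" by simp
      then have "\<forall>\<^sub>F t in \<F>. edist_set x (C t) \<le> ereal e"
        by (rule eventually_mono) simp
      then show "?L \<le> 0 + ereal e" by (simp add: Limsup_bounded)
    qed
    moreover have "0 \<le> Liminf \<F> (\<lambda>t. edist_set x (C t))"
      by (intro Liminf_bounded always_eventually allI edist_set_nonneg)
    then have "0 \<le> ?L" using Liminf_le_Limsup[OF assms] by (rule order_trans)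
    ultimately show "?L = 0" by (rule antisym)
  qed
  then show ?thesis
    by (simp add: set_liminf_def edist_set_less_iff)
qed

lemma eventually_nhds_in:
  "eventually P (nhds_in z \<Omega>) \<longleftrightarrow> (\<exists>\<delta>>0. \<forall>z'\<in>\<Omega>. dist z' z < \<delta> \<longrightarrow> P z')"
  for z :: "'a::metric_space"
  unfolding nhds_in_def eventually_inf_principal eventually_nhds_metric by auto

lemma eventually_at_right_0:
  "eventually P (at_right 0) \<longleftrightarrow> (\<exists>\<delta>>0. \<forall>t. 0 < t \<and> t < \<delta> \<longrightarrow> P t)" for P :: "real \<Rightarrow> bool"
  by (auto simp: eventually_at_right[of 0 1])

lemma eventually_nhds_in_times_at_right_0:
  fixes z :: "'a::metric_space"
  shows "eventually P (nhds_in z \<Omega> \<times>\<^sub>F at_right (0::real)) \<longleftrightarrow>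
    (\<exists>\<delta>>0. \<forall>z'\<in>\<Omega>. \<forall>t. dist z' z < \<delta> \<and> 0 < t \<and> t < \<delta> \<longrightarrow> P (z', t))"
proof
  assume "eventually P (nhds_in z \<Omega> \<times>\<^sub>F at_right (0::real))"
  then obtain Pf Pg where ev: "eventually Pf (nhds_in z \<Omega>)" "eventually Pg (at_right (0::real))"
    and PP: "\<And>x y. Pf x \<Longrightarrow> Pg y \<Longrightarrow> P (x, y)"
    unfolding eventually_prod_filter by blast
  obtain d1 where d1: "d1 > 0" "\<forall>z'\<in>\<Omega>. dist z' z < d1 \<longrightarrow> Pf z'"
    using ev(1) unfolding eventually_nhds_in by blast
  obtain d2 where d2: "d2 > 0" "\<forall>t. 0 < t \<and> t < d2 \<longrightarrow> Pg t"
    using ev(2) unfolding eventually_at_right_0 by blast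
  show "\<exists>\<delta>>0. \<forall>z'\<in>\<Omega>. \<forall>t. dist z' z < \<delta> \<and> 0 < t \<and> t < \<delta> \<longrightarrow> P (z', t)"
    using d1 d2 PP by (intro exI[of _ "min d1 d2"]) auto
next
  assume "\<exists>\<delta>>0. \<forall>z'\<in>\<Omega>. \<forall>t. dist z' z < \<delta> \<and> 0 < t \<and> t < \<delta> \<longrightarrow> P (z', t)"
  then obtain d where d: "d > 0" "\<forall>z'\<in>\<Omega>. \<forall>t. dist z' z < d \<and> 0 < t \<and> t < d \<longrightarrow> P (z', t)"
    by blast
  show "eventually P (nhds_in z \<Omega> \<times>\<^sub>F at_right (0::real))"
    unfolding eventually_prod_filter eventually_nhds_in eventually_at_right_0
    by (rule exI[of _ "\<lambda>z'. z' \<in> \<Omega> \<and> dist z' z < d"], rule exI[of _ "\<lambda>t. 0 < t \<and> t < d"])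
       (use d in blast)
qed

lemma mem_tangent_cone_iff:
  "w \<in> tangent_cone \<Omega> z \<longleftrightarrow>
    (\<forall>e>0. \<forall>\<delta>>0. \<exists>t p. 0 < t \<and> t < \<delta> \<and> p \<in> \<Omega> \<and> dist w ((p - z) /\<^sub>R t) < e)"
  unfolding tangent_cone_def mem_set_limsup_iff frequently_def eventually_at_right_0
    diff_quotient_set_def
  by (simp add: not_le) blast

text \<open>Diagonal choice with error \<open>1 / (k + 1)\<close> turns the set limit into the familiar description
  of the Bouligand tangent cone by sequences.\<close>

lemma mem_tangent_cone_sequential:
  "w \<in> tangent_cone \<Omega> z \<longleftrightarrow>
    (\<exists>t p. (\<forall>k. 0 < t k) \<and> t \<longlonglongrightarrow> 0 \<and> (\<forall>k. p k \<in> \<Omega>) \<and> (\<lambda>k. (p k - z) /\<^sub>R t k) \<longlonglongrightarrow> w)"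
proof
  assume w: "w \<in> tangent_cone \<Omega> z"
  have "\<forall>k. \<exists>t p. 0 < t \<and> t < inverse (real (Suc k)) \<and> p \<in> \<Omega> \<and>
      dist w ((p - z) /\<^sub>R t) < inverse (real (Suc k))"
    using w unfolding mem_tangent_cone_iff
    by (metis inverse_positive_iff_positive of_nat_0_less_iff zero_less_Suc)
  then obtain t p where *: "\<And>k. 0 < t k" "\<And>k. t k < inverse (real (Suc k))" "\<And>k. p k \<in> \<Omega>"
      "\<And>k. dist w ((p k - z) /\<^sub>R t k) < inverse (real (Suc k))"
    by metis
  have "t \<longlonglongrightarrow> 0"
  proof (rule tendsto_sandwich[OF _ _ tendsto_const LIMSEQ_inverse_real_of_nat])
    show "\<forall>\<^sub>F k in sequentially. 0 \<le> t k"
      by (intro always_eventually allI less_imp_le *(1))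
    show "\<forall>\<^sub>F k in sequentially. t k \<le> inverse (real (Suc k))"
      by (intro always_eventually allI less_imp_le *(2))
  qed
  moreover have "(\<lambda>k. dist ((p k - z) /\<^sub>R t k) w) \<longlonglongrightarrow> 0"
  proof (rule tendsto_sandwich[OF _ _ tendsto_const LIMSEQ_inverse_real_of_nat])
    show "\<forall>\<^sub>F k in sequentially. dist ((p k - z) /\<^sub>R t k) w \<le> inverse (real (Suc k))"
      by (subst dist_commute) (intro always_eventually allI less_imp_le *(4))
  qed simp
  then have "(\<lambda>k. (p k - z) /\<^sub>R t k) \<longlonglongrightarrow> w" by (rule tendsto_dist_iff[THEN iffD2])
  ultimately show "\<exists>t p. (\<forall>k. 0 < t k) \<and> t \<longlonglongrightarrow> 0 \<and> (\<forall>k. p k \<in> \<Omega>) \<and> (\<lambda>k. (p k - z) /\<^sub>R t k) \<longlonglongrightarrow> w"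
    by (intro exI[of _ t] exI[of _ p] conjI allI *(1,3))
next
  assume "\<exists>t p. (\<forall>k. 0 < t k) \<and> t \<longlonglongrightarrow> 0 \<and> (\<forall>k. p k \<in> \<Omega>) \<and> (\<lambda>k. (p k - z) /\<^sub>R t k) \<longlonglongrightarrow> w"
  then obtain t p where *: "\<And>k. 0 < t k" "t \<longlonglongrightarrow> 0" "\<And>k. p k \<in> \<Omega>"
      "(\<lambda>k. (p k - z) /\<^sub>R t k) \<longlonglongrightarrow> w"
    by blast
  show "w \<in> tangent_cone \<Omega> z"
    unfolding mem_tangent_cone_iff
  proof (intro allI impI)
    fix e d :: real assume "e > 0" "d > 0"
    have "\<forall>\<^sub>F k in sequentially. t k < d" using *(2) \<open>d > 0\<close> by (rule order_tendstoD)
    moreover have "\<forall>\<^sub>F k in sequentially. dist ((p k - z) /\<^sub>R t k) w < e"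
      using *(4) \<open>e > 0\<close> by (rule tendstoD)
    ultimately have "\<forall>\<^sub>F k in sequentially. t k < d \<and> dist ((p k - z) /\<^sub>R t k) w < e"
      by (rule eventually_conj)
    then obtain k where "t k < d" "dist ((p k - z) /\<^sub>R t k) w < e"
      by (auto dest!: eventually_happens'[OF sequentially_bot])
    then show "\<exists>t p. 0 < t \<and> t < d \<and> p \<in> \<Omega> \<and> dist w ((p - z) /\<^sub>R t) < e"
      using *(1,3) by (intro exI[of _ "t k"] exI[of _ "p k"]) (simp add: dist_commute)
  qed
qed

lemma tendsto_of_convergent_quotients:
  fixes y :: "nat \<Rightarrow> 'a::real_normed_vector"
  assumes t: "\<And>k. 0 < t k" "t \<longlonglongrightarrow> 0" and lim: "(\<lambda>k. (y k - x) /\<^sub>R t k) \<longlonglongrightarrow> w"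
  shows "y \<longlonglongrightarrow> x"
proof -
  have "(\<lambda>k. t k *\<^sub>R ((y k - x) /\<^sub>R t k) + x) \<longlonglongrightarrow> 0 *\<^sub>R w + x"
    by (intro tendsto_intros t(2) lim)
  moreover have "t k *\<^sub>R ((y k - x) /\<^sub>R t k) + x = y k" for k
    using t(1)[of k] by simp
  ultimately show ?thesis by simp
qed

lemma null_sequence_below:
  fixes \<delta> :: real
  assumes \<delta>: "\<delta> > 0"
  obtains t :: "nat \<Rightarrow> real" where "\<And>k. 0 < t k" "\<And>k. t k < \<delta>" "t \<longlonglongrightarrow> 0"
proof -
  define t where "t k = \<delta> * inverse (real (Suc (Suc k)))" for k
  have "0 < t k" "t k < \<delta>" for k using \<delta> by (auto simp: t_def field_simps add_pos_nonneg)
  moreover have "(\<lambda>k. \<delta> * inverse (real (Suc (Suc k)))) \<longlonglongrightarrow> \<delta> * 0"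
    by (intro tendsto_mult tendsto_const LIMSEQ_Suc[OF LIMSEQ_inverse_real_of_nat])
  then have "t \<longlonglongrightarrow> 0" unfolding t_def by simp
  ultimately show thesis by (rule that)
qed

text \<open>In finite dimension bounded difference quotients always produce a tangent vector; this is
  how tangent vectors are constructed from estimates below.\<close>

lemma tangent_of_bounded_quotients:
  fixes \<Omega> :: "'a::euclidean_space set"
  assumes "\<And>k. 0 < t k" "t \<longlonglongrightarrow> 0" "\<And>k. p k \<in> \<Omega>"
    and bd: "\<And>k. norm ((p k - z) /\<^sub>R t k) \<le> M"
  obtains w r where "w \<in> tangent_cone \<Omega> z" "strict_mono (r :: nat \<Rightarrow> nat)"
    "(\<lambda>k. (p (r k) - z) /\<^sub>R t (r k)) \<longlonglongrightarrow> w"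
proof -
  have "\<forall>k. (p k - z) /\<^sub>R t k \<in> cball 0 M" using bd by simp
  then obtain w r where r: "strict_mono (r :: nat \<Rightarrow> nat)"
      "((\<lambda>k. (p k - z) /\<^sub>R t k) \<circ> r) \<longlonglongrightarrow> w"
    using compact_cball[of "0::'a" M] unfolding compact_def by meson
  have "w \<in> tangent_cone \<Omega> z"
    unfolding mem_tangent_cone_sequential
    by (rule exI[of _ "t \<circ> r"], rule exI[of _ "p \<circ> r"])
       (use assms r in \<open>auto simp: o_def intro: LIMSEQ_subseq_LIMSEQ[OF assms(2), unfolded o_def]\<close>)
  then show thesis using r that by (simp add: o_def)
qed

section \<open>The tangent space of a strictly smooth set\<close>

text \<open>For fixed base point \<open>z\<close> the tangent cone lies between the inner and the outer limit taken with
  moving base points. Strict smoothness makes these two equal, so that one may pass from the weakest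
  way of being tangent (along some base points, some steps) to the strongest one (uniformly over all
  nearby base points and all small steps). Everything below rests on this gain.\<close>

lemma
  fixes \<Omega> :: "'a::real_normed_vector set"
  assumes "strictly_smooth_at \<Omega> z" "z \<in> \<Omega>"
  shows strictly_smooth_limsup:
      "(\<And>e \<delta>. e > 0 \<Longrightarrow> \<delta> > 0 \<Longrightarrow> \<exists>z'\<in>\<Omega>. \<exists>t. \<exists>p\<in>\<Omega>. dist z' z < \<delta> \<and> 0 < t \<and> t < \<delta> \<and>
          dist w ((p - z') /\<^sub>R t) < e) \<Longrightarrow> w \<in> tangent_cone \<Omega> z"
    and strictly_smooth_liminf:
      "w \<in> tangent_cone \<Omega> z \<Longrightarrow> e > 0 \<Longrightarrow> \<exists>\<delta>>0. \<forall>z'\<in>\<Omega>. \<forall>t. dist z' z < \<delta> \<and> 0 < t \<and> t < \<delta> \<longrightarrow>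
          (\<exists>p\<in>\<Omega>. dist w ((p - z') /\<^sub>R t) < e)"
proof -
  let ?F = "nhds_in z \<Omega> \<times>\<^sub>F at_right (0::real)"
  let ?C = "\<lambda>(z', t). diff_quotient_set \<Omega> z' t"
  have eq: "set_limsup ?F ?C = set_liminf ?F ?C"
    using assms(1) by (simp add: strictly_smooth_at_def set_limit_exists_def)
  have nb: "?F \<noteq> bot"
  proof
    assume "?F = bot"
    then have "eventually (\<lambda>_. False) ?F" by simp
    then obtain d where d: "d > 0" "\<forall>z'\<in>\<Omega>. \<forall>t. \<not> (dist z' z < d \<and> 0 < t \<and> t < d)"
      unfolding eventually_nhds_in_times_at_right_0 by blast
    then show False using assms(2) dense[of 0 d] by force
  qed
  have sup: "w \<in> set_limsup ?F ?C \<longleftrightarrow> (\<forall>e>0. \<forall>\<delta>>0. \<exists>z'\<in>\<Omega>. \<exists>t. \<exists>p\<in>\<Omega>. dist z' z < \<delta> \<and> 0 < t \<and> t < \<delta> \<and>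
          dist w ((p - z') /\<^sub>R t) < e)" for w
    unfolding mem_set_limsup_iff frequently_def eventually_nhds_in_times_at_right_0
      diff_quotient_set_def by (simp add: not_le)
  have inf: "w \<in> set_liminf ?F ?C \<longleftrightarrow> (\<forall>e>0. \<exists>\<delta>>0. \<forall>z'\<in>\<Omega>. \<forall>t. dist z' z < \<delta> \<and> 0 < t \<and> t < \<delta> \<longrightarrow>
          (\<exists>p\<in>\<Omega>. dist w ((p - z') /\<^sub>R t) < e))" for w
    unfolding mem_set_liminf_iff[OF nb] eventually_nhds_in_times_at_right_0
      diff_quotient_set_def by simp
  have 1: "w \<in> tangent_cone \<Omega> z" if "w \<in> set_liminf ?F ?C" for w
    unfolding mem_tangent_cone_iff
  proof (intro allI impI)
    fix e d :: real assume "e > 0" "d > 0"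
    obtain d' where d': "d' > 0" "\<And>z' t. z' \<in> \<Omega> \<Longrightarrow> dist z' z < d' \<and> 0 < t \<and> t < d' \<Longrightarrow>
          (\<exists>p\<in>\<Omega>. dist w ((p - z') /\<^sub>R t) < e)"
      using inf[THEN iffD1, OF \<open>w \<in> set_liminf ?F ?C\<close>, rule_format, OF \<open>e > 0\<close>] by blast
    obtain t where t: "0 < t" "t < min d d'" using \<open>d > 0\<close> \<open>d' > 0\<close> dense[of 0 "min d d'"] by auto
    then show "\<exists>t p. 0 < t \<and> t < d \<and> p \<in> \<Omega> \<and> dist w ((p - z) /\<^sub>R t) < e"
      using d'(2)[OF assms(2), of t] d'(1) by auto
  qed
  have 2: "w \<in> set_limsup ?F ?C" if "w \<in> tangent_cone \<Omega> z" for w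
    unfolding sup
  proof (intro allI impI)
    fix e d :: real assume "e > 0" "d > 0"
    with that obtain t p where "0 < t" "t < d" "p \<in> \<Omega>" "dist w ((p - z) /\<^sub>R t) < e"
      unfolding mem_tangent_cone_iff by blast
    then show "\<exists>z'\<in>\<Omega>. \<exists>t. \<exists>p\<in>\<Omega>. dist z' z < d \<and> 0 < t \<and> t < d \<and> dist w ((p - z') /\<^sub>R t) < e"
      using assms(2) \<open>d > 0\<close> by (intro bexI[of _ z]) auto
  qed
  { assume "\<And>e \<delta>. e > 0 \<Longrightarrow> \<delta> > 0 \<Longrightarrow> \<exists>z'\<in>\<Omega>. \<exists>t. \<exists>p\<in>\<Omega>. dist z' z < \<delta> \<and> 0 < t \<and> t < \<delta> \<and>
          dist w ((p - z') /\<^sub>R t) < e"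
    then have "w \<in> set_limsup ?F ?C" unfolding sup by blast
    then show "w \<in> tangent_cone \<Omega> z" using 1 eq by blast }
  { assume "w \<in> tangent_cone \<Omega> z" "e > 0"
    then have "w \<in> set_liminf ?F ?C" using 2 eq by blast
    from inf[THEN iffD1, OF this, rule_format, OF \<open>e > 0\<close>]
    show "\<exists>\<delta>>0. \<forall>z'\<in>\<Omega>. \<forall>t. dist z' z < \<delta> \<and> 0 < t \<and> t < \<delta> \<longrightarrow>
          (\<exists>p\<in>\<Omega>. dist w ((p - z') /\<^sub>R t) < e)" . }
qed

lemma dist_le_of_quotient:
  fixes p z w :: "'a::real_normed_vector"
  assumes "dist w ((p - z) /\<^sub>R t) < e" "0 < t"
  shows "dist p z \<le> t * (norm w + e)"
proof -
  have "norm ((p - z) /\<^sub>R t) \<le> norm w + e"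
    using assms(1) norm_triangle_ineq2[of "(p - z) /\<^sub>R t" w] by (simp add: dist_norm norm_minus_commute)
  then have "t * norm ((p - z) /\<^sub>R t) \<le> t * (norm w + e)"
    using \<open>0 < t\<close> by (intro mult_left_mono) auto
  moreover have "t * norm ((p - z) /\<^sub>R t) = norm (p - z)" using \<open>0 < t\<close> by simp
  ultimately show ?thesis by (simp only: dist_norm)
qed

text \<open>A sum of tangent vectors is realised by two consecutive steps, the second one starting at the
  point reached by the first; this needs the approximation to be uniform in the base point. The
  negative of a tangent vector is realised by exchanging the base point with the point reached,
  which needs the freedom to choose the base point.\<close>

lemma subspace_tangent_cone:
  fixes \<Omega> :: "'a::real_normed_vector set"
  assumes sm: "strictly_smooth_at \<Omega> z" and z: "z \<in> \<Omega>"
  shows "subspace (tangent_cone \<Omega> z)"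
proof -
  let ?K = "tangent_cone \<Omega> z"
  have zero: "0 \<in> ?K"
    unfolding mem_tangent_cone_iff
  proof (intro allI impI)
    fix e d :: real assume "e > 0" "d > 0"
    then show "\<exists>t p. 0 < t \<and> t < d \<and> p \<in> \<Omega> \<and> dist 0 ((p - z) /\<^sub>R t) < e"
      using z by (intro exI[of _ "d/2"] exI[of _ z]) auto
  qed
  have add: "v + w \<in> ?K" if v: "v \<in> ?K" and w: "w \<in> ?K" for v w
    unfolding mem_tangent_cone_iff
  proof (intro allI impI)
    fix e d :: real assume "e > 0" "d > 0"
    obtain d1 where d1: "d1 > 0" "\<And>z' t. z' \<in> \<Omega> \<Longrightarrow> dist z' z < d1 \<Longrightarrow> 0 < t \<Longrightarrow> t < d1 \<Longrightarrow>
          \<exists>p\<in>\<Omega>. dist v ((p - z') /\<^sub>R t) < e/2"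
      using strictly_smooth_liminf[OF sm z v, of "e/2"] \<open>e > 0\<close> by auto
    obtain d2 where d2: "d2 > 0" "\<And>z' t. z' \<in> \<Omega> \<Longrightarrow> dist z' z < d2 \<Longrightarrow> 0 < t \<Longrightarrow> t < d2 \<Longrightarrow>
          \<exists>p\<in>\<Omega>. dist w ((p - z') /\<^sub>R t) < e/2"
      using strictly_smooth_liminf[OF sm z w, of "e/2"] \<open>e > 0\<close> by auto
    define M where "M = norm v + e/2"
    have M: "M > 0" using \<open>e > 0\<close> by (simp add: M_def add_nonneg_pos)
    obtain t where t: "0 < t" "t < min (min d d1) (min d2 (d2 / M))"
      using dense[of 0 "min (min d d1) (min d2 (d2 / M))"] \<open>d > 0\<close> d1 d2 M by auto
    obtain p where p: "p \<in> \<Omega>" "dist v ((p - z) /\<^sub>R t) < e/2"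
      using d1(2)[OF z, of t] d1(1) t by auto
    have "dist p z \<le> t * M" using dist_le_of_quotient[OF p(2) t(1)] by (simp add: M_def)
    also have "\<dots> < d2" using t M by (simp add: field_simps)
    finally obtain q where q: "q \<in> \<Omega>" "dist w ((q - p) /\<^sub>R t) < e/2"
      using d2(2)[OF p(1), of t] t by auto
    have "(q - z) /\<^sub>R t = (p - z) /\<^sub>R t + (q - p) /\<^sub>R t"
      by (simp add: algebra_simps)
    then have "dist (v + w) ((q - z) /\<^sub>R t) < e"
      using dist_triangle_add[of v w "(p - z) /\<^sub>R t" "(q - p) /\<^sub>R t"] p q by simp
    then show "\<exists>t p. 0 < t \<and> t < d \<and> p \<in> \<Omega> \<and> dist (v + w) ((p - z) /\<^sub>R t) < e"
      using t q by auto
  qed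
  have pos: "c *\<^sub>R w \<in> ?K" if w: "w \<in> ?K" and c: "c > 0" for c w
    unfolding mem_tangent_cone_iff
  proof (intro allI impI)
    fix e d :: real assume "e > 0" "d > 0"
    then have "e / c > 0" "c * d > 0" using c by auto
    with w obtain t p where *: "0 < t" "t < c * d" "p \<in> \<Omega>" "dist w ((p - z) /\<^sub>R t) < e / c"
      unfolding mem_tangent_cone_iff by blast
    have "dist (c *\<^sub>R w) (c *\<^sub>R ((p - z) /\<^sub>R t)) = c * dist w ((p - z) /\<^sub>R t)"
      using c by (simp only: dist_norm scaleR_right_diff_distrib[symmetric] norm_scaleR abs_of_pos)
    also have "\<dots> < e" using *(4) c by (simp add: field_simps)
    finally have "dist (c *\<^sub>R w) ((p - z) /\<^sub>R (t / c)) < e"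
      by (simp add: divide_inverse mult.commute)
    then show "\<exists>t p. 0 < t \<and> t < d \<and> p \<in> \<Omega> \<and> dist (c *\<^sub>R w) ((p - z) /\<^sub>R t) < e"
      using * c by (intro exI[of _ "t / c"] exI[of _ p]) (auto simp: field_simps)
  qed
  have neg: "- w \<in> ?K" if w: "w \<in> ?K" for w
  proof (rule strictly_smooth_limsup[OF sm z])
    fix e d :: real assume "e > 0" "d > 0"
    define M where "M = norm w + e"
    have M: "M > 0" using \<open>e > 0\<close> by (simp add: M_def add_nonneg_pos)
    have "min d (d / M) > 0" using \<open>d > 0\<close> M by simp
    with w \<open>e > 0\<close> obtain t p where *: "0 < t" "t < min d (d / M)" "p \<in> \<Omega>"
        "dist w ((p - z) /\<^sub>R t) < e"
      unfolding mem_tangent_cone_iff by blast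
    have "dist p z \<le> t * M" using dist_le_of_quotient[OF *(4,1)] by (simp add: M_def)
    also have "\<dots> < d" using * M by (simp add: field_simps)
    finally have "dist p z < d" .
    moreover have "dist (- w) ((z - p) /\<^sub>R t) < e"
    proof -
      have "(z - p) /\<^sub>R t = - ((p - z) /\<^sub>R t)" by (simp add: algebra_simps)
      then show ?thesis using *(4) by (simp only: dist_minus)
    qed
    ultimately show "\<exists>z'\<in>\<Omega>. \<exists>t. \<exists>p\<in>\<Omega>. dist z' z < d \<and> 0 < t \<and> t < d \<and> dist (- w) ((p - z') /\<^sub>R t) < e"
      using * z by (intro bexI[of _ p] exI[of _ t] bexI[of _ z]) auto
  qed
  have "c *\<^sub>R w \<in> ?K" if "w \<in> ?K" for c w
    using pos[OF that, of c] neg[OF pos[OF that, of "- c"]] zero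
    by (cases c "0::real" rule: linorder_cases) auto
  then show ?thesis using zero add by (simp add: subspace_def)
qed

section \<open>Normal cone and uniform estimates\<close>

text \<open>Compactness turns approximate difference quotients for all small steps into an exact tangent
  vector at the same base point, at the price of a non-strict estimate.\<close>

lemma tangent_near:
  fixes \<Omega> :: "'a::euclidean_space set"
  assumes \<delta>: "\<delta> > 0" and near: "\<And>t. 0 < t \<Longrightarrow> t < \<delta> \<Longrightarrow> \<exists>p\<in>\<Omega>. dist w ((p - z) /\<^sub>R t) < e"
  obtains w' where "w' \<in> tangent_cone \<Omega> z" "dist w w' \<le> e"
proof -
  obtain t where t: "\<And>k. 0 < t k" "\<And>k. t k < \<delta>" and t0: "t \<longlonglongrightarrow> 0"
    using null_sequence_below[OF \<delta>] by blast
  obtain p where p: "\<And>k. p k \<in> \<Omega>" "\<And>k. dist w ((p k - z) /\<^sub>R t k) < e"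
    using near[OF t] by metis
  have bd: "norm ((p k - z) /\<^sub>R t k) \<le> norm w + e" for k
    using p(2)[of k] norm_triangle_ineq2[of "(p k - z) /\<^sub>R t k" w]
    by (simp add: dist_norm norm_minus_commute)
  obtain w' r where w': "w' \<in> tangent_cone \<Omega> z" "strict_mono r"
      and lim: "(\<lambda>k. (p (r k) - z) /\<^sub>R t (r k)) \<longlonglongrightarrow> w'"
    by (rule tangent_of_bounded_quotients[OF t(1) t0 p(1) bd])
  have "(\<lambda>k. dist w ((p (r k) - z) /\<^sub>R t (r k))) \<longlonglongrightarrow> dist w w'"
    by (intro tendsto_dist tendsto_const lim)
  then have "dist w w' \<le> e"
    by (rule LIMSEQ_le_const2) (use p(2) less_imp_le in blast)
  with w' that show thesis by blast
qed

lemma mem_limiting_normal_cone_iff: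
  fixes \<Omega> :: "'a::euclidean_space set"
  shows "n \<in> limiting_normal_cone \<Omega> z \<longleftrightarrow>
    (\<forall>e>0. \<forall>\<delta>>0. \<exists>z'\<in>\<Omega>. dist z' z < \<delta> \<and> (\<exists>n'\<in>regular_normal_cone \<Omega> z'. dist n n' < e))"
  unfolding limiting_normal_cone_def mem_set_limsup_iff frequently_def eventually_nhds_in
  by blast

text \<open>A tangent vector \<open>w\<close> at \<open>z\<close> is close to tangent vectors at all base points near \<open>z\<close>, so a
  limit of regular normals at these points still satisfies \<open>n \<bullet> w \<le> 0\<close>, and even equality because the
  tangent cone is a subspace. Conversely the annihilator of this subspace is its polar, that is, the
  regular normal cone at \<open>z\<close> itself.\<close>

lemma limiting_normal_cone_strictly_smooth:
  fixes \<Omega> :: "'a::euclidean_space set"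
  assumes sm: "strictly_smooth_at \<Omega> z" and z: "z \<in> \<Omega>"
  shows "limiting_normal_cone \<Omega> z = {n. \<forall>w\<in>tangent_cone \<Omega> z. n \<bullet> w = 0}"
proof -
  let ?K = "tangent_cone \<Omega> z"
  have sub: "subspace ?K" by (rule subspace_tangent_cone[OF sm z])
  have le: "n \<bullet> w \<le> 0" if n: "n \<in> limiting_normal_cone \<Omega> z" and w: "w \<in> ?K" for n w
  proof (rule field_le_epsilon)
    fix e' :: real assume "e' > 0"
    define M where "M = norm n + 1 + norm w"
    have M: "M > 0" by (simp add: M_def add_nonneg_pos add_pos_nonneg)
    define e where "e = min 1 (e' / M)"
    have e: "e > 0" "e \<le> 1" "e * M \<le> e'"
      using \<open>e' > 0\<close> M by (auto simp: e_def min_def field_simps)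
    obtain d where d: "d > 0" "\<And>z' t. z' \<in> \<Omega> \<Longrightarrow> dist z' z < d \<Longrightarrow> 0 < t \<Longrightarrow> t < d \<Longrightarrow>
          \<exists>p\<in>\<Omega>. dist w ((p - z') /\<^sub>R t) < e"
      using strictly_smooth_liminf[OF sm z w e(1)] by auto
    obtain z' n' where z': "z' \<in> \<Omega>" "dist z' z < d" and n': "n' \<in> regular_normal_cone \<Omega> z'" "dist n n' < e"
      using n e(1) d(1) unfolding mem_limiting_normal_cone_iff by blast
    obtain w' where w': "w' \<in> tangent_cone \<Omega> z'" "dist w w' \<le> e"
      by (rule tangent_near[OF d(1) d(2)[OF z']])
    have "n' \<bullet> w' \<le> 0"
      using n'(1) w'(1) by (auto simp: regular_normal_cone_def polar_cone_def)
    moreover have "n' \<bullet> (w - w') \<le> (norm n + 1) * e"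
    proof -
      have "norm n' \<le> norm n + 1"
        using n'(2) e(2) norm_triangle_ineq2[of n' n] by (simp add: dist_norm norm_minus_commute)
      then have "norm n' * norm (w - w') \<le> (norm n + 1) * e"
        using w'(2) by (intro mult_mono) (auto simp: dist_norm)
      then show ?thesis using norm_cauchy_schwarz[of n' "w - w'"] by linarith
    qed
    moreover have "(n - n') \<bullet> w \<le> e * norm w"
    proof -
      have "norm (n - n') * norm w \<le> e * norm w"
        using n'(2) by (intro mult_right_mono) (auto simp: dist_norm)
      then show ?thesis using norm_cauchy_schwarz[of "n - n'" w] by linarith
    qed
    moreover have "n \<bullet> w = n' \<bullet> w' + n' \<bullet> (w - w') + (n - n') \<bullet> w"
      by (simp add: inner_diff_left inner_diff_right)
    moreover have "e * M = (norm n + 1) * e + e * norm w" by (simp add: M_def algebra_simps)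
    ultimately have "n \<bullet> w \<le> e * M" by linarith
    with e show "n \<bullet> w \<le> 0 + e'" by simp
  qed
  show ?thesis
  proof (intro set_eqI iffI; unfold mem_Collect_eq)
    fix n assume n: "n \<in> limiting_normal_cone \<Omega> z"
    show "\<forall>w\<in>?K. n \<bullet> w = 0"
    proof
      fix w assume w: "w \<in> ?K"
      show "n \<bullet> w = 0"
        using le[OF n w] le[OF n subspace_neg[OF sub w]] by simp
    qed
  next
    fix n assume n: "\<forall>w\<in>?K. n \<bullet> w = 0"
    then have "n \<in> regular_normal_cone \<Omega> z"
      by (simp add: regular_normal_cone_def polar_cone_def)
    then show "n \<in> limiting_normal_cone \<Omega> z"
      unfolding mem_limiting_normal_cone_iff
      by (intro allI impI bexI[OF _ z] conjI bexI[of _ n]) auto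
  qed
qed

text \<open>Secants of \<open>\<Omega>\<close> near \<open>z\<close> are uniformly close to the tangent space: by compactness of the unit
  sphere, normalised secants violating the estimate would accumulate at a tangent vector on which
  \<open>G\<close> is not zero. The map \<open>G\<close> measures the deviation from the tangent space, so that no
  distance to a subspace has to be handled.\<close>

lemma strictly_smooth_annihilator_small:
  fixes \<Omega> :: "'a::euclidean_space set" and G :: "'a \<Rightarrow> 'b::real_normed_vector"
  assumes sm: "strictly_smooth_at \<Omega> z" and z: "z \<in> \<Omega>"
    and G: "bounded_linear G" and van: "\<And>w. w \<in> tangent_cone \<Omega> z \<Longrightarrow> G w = 0"
    and e: "e > 0"
  shows "\<exists>\<delta>>0. \<forall>p\<in>\<Omega>. \<forall>q\<in>\<Omega>. dist p z < \<delta> \<longrightarrow> dist q z < \<delta> \<longrightarrow> norm (G (q - p)) \<le> e * norm (q - p)"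
proof (rule ccontr)
  interpret G: bounded_linear G by fact
  assume "\<not> ?thesis"
  then have "\<exists>p\<in>\<Omega>. \<exists>q\<in>\<Omega>. dist p z < inverse (real (Suc k)) \<and> dist q z < inverse (real (Suc k)) \<and>
      e * norm (q - p) < norm (G (q - p))" for k
    by (metis inverse_positive_iff_positive not_less of_nat_0_less_iff zero_less_Suc)
  then obtain p q where p: "\<And>k. p k \<in> \<Omega>" "\<And>k. dist (p k) z < inverse (real (Suc k))"
      and q: "\<And>k. q k \<in> \<Omega>" "\<And>k. dist (q k) z < inverse (real (Suc k))"
      and G_large: "\<And>k. e * norm (q k - p k) < norm (G (q k - p k))"
    by metis
  have p_lim: "p \<longlonglongrightarrow> z"
    by (rule metric_tendsto_imp_tendsto[OF LIMSEQ_inverse_real_of_nat])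
       (use p(2) in \<open>auto intro!: always_eventually less_imp_le simp del: of_nat_Suc\<close>)
  have q_lim: "q \<longlonglongrightarrow> z"
    by (rule metric_tendsto_imp_tendsto[OF LIMSEQ_inverse_real_of_nat])
       (use q(2) in \<open>auto intro!: always_eventually less_imp_le simp del: of_nat_Suc\<close>)
  define t where "t k = norm (q k - p k)" for k
  have "(\<lambda>k. norm (q k - p k)) \<longlonglongrightarrow> norm (z - z)"
    by (intro tendsto_norm tendsto_diff p_lim q_lim)
  then have t0: "t \<longlonglongrightarrow> 0" by (simp add: t_def[abs_def])
  have t: "0 < t k" for k
    using G_large[of k] by (cases "q k = p k") (auto simp: t_def G.zero)
  define u where "u k = (q k - p k) /\<^sub>R t k" for k
  have "norm (u k) = 1" for k
    using t[of k] by (simp add: u_def) (simp add: t_def)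
  then have "\<forall>k. u k \<in> sphere 0 1" by simp
  then obtain w r where r: "strict_mono (r :: nat \<Rightarrow> nat)" "(u \<circ> r) \<longlonglongrightarrow> w"
    using compact_sphere[of "0::'a" 1] unfolding compact_def by blast
  have "w \<in> tangent_cone \<Omega> z"
  proof (rule strictly_smooth_limsup[OF sm z])
    fix e d :: real assume "e > 0" "d > 0"
    have "\<forall>\<^sub>F k in sequentially. dist ((u \<circ> r) k) w < e" using r(2) \<open>e > 0\<close> by (rule tendstoD)
    moreover have "\<forall>\<^sub>F k in sequentially. dist ((p \<circ> r) k) z < d"
      using LIMSEQ_subseq_LIMSEQ[OF p_lim r(1)] \<open>d > 0\<close> by (rule tendstoD)
    moreover have "\<forall>\<^sub>F k in sequentially. (t \<circ> r) k < d"
      using LIMSEQ_subseq_LIMSEQ[OF t0 r(1)] \<open>d > 0\<close> by (rule order_tendstoD)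
    ultimately have "\<forall>\<^sub>F k in sequentially. dist ((u \<circ> r) k) w < e \<and> dist ((p \<circ> r) k) z < d \<and> (t \<circ> r) k < d"
      by (intro eventually_conj)
    then obtain k where "dist ((u \<circ> r) k) w < e" "dist ((p \<circ> r) k) z < d" "(t \<circ> r) k < d"
      by (auto dest!: eventually_happens'[OF sequentially_bot])
    then show "\<exists>z'\<in>\<Omega>. \<exists>t. \<exists>p\<in>\<Omega>. dist z' z < d \<and> 0 < t \<and> t < d \<and> dist w ((p - z') /\<^sub>R t) < e"
      using p(1) q(1) t by (intro bexI[of _ "p (r k)"] exI[of _ "t (r k)"] bexI[of _ "q (r k)"])
        (auto simp: u_def dist_commute)
  qed
  then have "G w = 0" by (rule van)
  have "(\<lambda>k. norm (G ((u \<circ> r) k))) \<longlonglongrightarrow> norm (G w)"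
    by (intro tendsto_norm G.tendsto r(2))
  moreover have "e \<le> norm (G ((u \<circ> r) k))" for k
  proof -
    have "norm (G (u (r k))) = norm (G (q (r k) - p (r k))) / t (r k)"
      using t[of "r k"] by (simp only: u_def G.scaleR norm_scaleR) (simp add: divide_inverse)
    then show ?thesis
      using G_large[of "r k"] t[of "r k"] by (simp add: pos_le_divide_eq t_def)
  qed
  ultimately have "e \<le> norm (G w)" by (intro LIMSEQ_le_const) auto
  with \<open>G w = 0\<close> e show False by simp
qed

text \<open>The inner limit is uniform over compact sets of directions, by a finite net. This is needed
  because the direction used in the covering argument depends on the base point.\<close>

lemma strictly_smooth_tangents_uniform:
  fixes \<Omega> :: "'a::real_normed_vector set"
  assumes sm: "strictly_smooth_at \<Omega> z" and z: "z \<in> \<Omega>"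
    and S: "compact S" "S \<subseteq> tangent_cone \<Omega> z" and e: "e > 0"
  shows "\<exists>\<delta>>0. \<forall>w\<in>S. \<forall>z'\<in>\<Omega>. \<forall>t. dist z' z < \<delta> \<and> 0 < t \<and> t < \<delta> \<longrightarrow>
           (\<exists>p\<in>\<Omega>. dist w ((p - z') /\<^sub>R t) < e)"
proof -
  let ?F = "nhds_in z \<Omega> \<times>\<^sub>F at_right (0::real)"
  have "seq_compact S" using S(1) by (simp add: compact_eq_seq_compact_metric)
  from seq_compact_imp_totally_bounded[OF this] e
  obtain N where N: "finite N" "N \<subseteq> S" "S \<subseteq> (\<Union>w\<in>N. ball w (e/2))"
    by (metis half_gt_zero)
  have "\<forall>w\<in>N. \<forall>\<^sub>F x in ?F. \<exists>p\<in>\<Omega>. dist w ((p - fst x) /\<^sub>R snd x) < e/2"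
  proof
    fix w assume "w \<in> N"
    then have "w \<in> tangent_cone \<Omega> z" using N(2) S(2) by blast
    from strictly_smooth_liminf[OF sm z this, of "e/2"] e
    show "\<forall>\<^sub>F x in ?F. \<exists>p\<in>\<Omega>. dist w ((p - fst x) /\<^sub>R snd x) < e/2"
      unfolding eventually_nhds_in_times_at_right_0 fst_conv snd_conv by simp
  qed
  with N(1) have "\<forall>\<^sub>F x in ?F. \<forall>w\<in>N. \<exists>p\<in>\<Omega>. dist w ((p - fst x) /\<^sub>R snd x) < e/2"
    by (rule eventually_ball_finite)
  then obtain d where d: "d > 0" "\<And>z' t w. z' \<in> \<Omega> \<Longrightarrow> dist z' z < d \<and> 0 < t \<and> t < d \<Longrightarrow> w \<in> N \<Longrightarrow>
      \<exists>p\<in>\<Omega>. dist w ((p - z') /\<^sub>R t) < e/2"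
    unfolding eventually_nhds_in_times_at_right_0 fst_conv snd_conv by blast
  have "\<exists>p\<in>\<Omega>. dist w ((p - z') /\<^sub>R t) < e"
    if w: "w \<in> S" and *: "z' \<in> \<Omega>" "dist z' z < d \<and> 0 < t \<and> t < d" for w z' t
  proof -
    obtain w' where w': "w' \<in> N" "dist w' w < e/2" using N(3) w by auto
    obtain p where "p \<in> \<Omega>" "dist w' ((p - z') /\<^sub>R t) < e/2" using d(2)[OF * w'(1)] by blast
    then show ?thesis using w'(2) dist_triangle_half_r[of w' w e] by blast
  qed
  then show ?thesis using d(1) by blast
qed

section \<open>The localization of the inverse\<close>

text \<open>The projection of \<open>\<Omega>\<close> onto the second factor reaches every \<open>y\<close> near \<open>yb\<close>. The point of
  \<open>\<Omega> \<inter> cball (xb, yb) \<delta>\<close> whose second component is closest to \<open>y\<close> exists by compactness. The secant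
  estimate \<open>est\<close> keeps it off the boundary of the ball, and from an interior point with second
  component different from \<open>y\<close> a small step in the direction \<open>(C v, v)\<close>, where \<open>v\<close> points towards
  \<open>y\<close>, would come closer. The error \<open>1/2\<close> in \<open>move\<close> only has to be smaller than the length of \<open>v\<close>.\<close>

lemma strictly_smooth_covers:
  fixes \<Omega> :: "('a::euclidean_space \<times> 'b::euclidean_space) set" and C :: "'b \<Rightarrow> 'a"
  assumes z: "(xb, yb) \<in> \<Omega>" and cpt: "compact (\<Omega> \<inter> cball (xb, yb) \<delta>)"
    and C: "\<And>v. norm (C v) \<le> norm v * B" and L: "L > 0"
    and est: "\<And>p. p \<in> \<Omega> \<Longrightarrow> dist p (xb, yb) \<le> \<delta> \<Longrightarrow> dist p (xb, yb) \<le> L * dist (snd p) yb"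
    and move: "\<And>v p t. norm v = 1 \<Longrightarrow> p \<in> \<Omega> \<Longrightarrow> dist p (xb, yb) \<le> \<delta> \<Longrightarrow> 0 < t \<Longrightarrow> t < \<delta> \<Longrightarrow>
        \<exists>q\<in>\<Omega>. dist (C v, v) ((q - p) /\<^sub>R t) < 1/2"
    and y: "2 * L * dist y yb < \<delta>"
  obtains x where "(x, y) \<in> \<Omega>" "dist (x, y) (xb, yb) \<le> L * dist y yb"
proof -
  let ?z = "(xb, yb)"
  let ?Q = "\<Omega> \<inter> cball ?z \<delta>"
  have B: "B \<ge> 0"
  proof -
    obtain b :: 'b where "b \<in> Basis" using nonempty_Basis by blast
    then have "norm b = 1" by simp
    then show ?thesis using order_trans[OF norm_ge_zero C[of b]] by simp
  qed
  have \<delta>: "\<delta> > 0"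
    using L by (intro le_less_trans[OF _ y]) simp
  have zQ: "?z \<in> ?Q" using z \<delta> by simp
  obtain p where p: "p \<in> ?Q" and min: "\<And>q. q \<in> ?Q \<Longrightarrow> dist y (snd p) \<le> dist y (snd q)"
  proof -
    have "continuous_on ?Q (\<lambda>q. dist y (snd q))" by (intro continuous_intros)
    with cpt zQ that show thesis using continuous_attains_inf[of ?Q "\<lambda>q. dist y (snd q)"] by blast
  qed
  have pO: "p \<in> \<Omega>" "dist p ?z \<le> \<delta>" using p by (auto simp: dist_commute)
  have "dist (snd p) yb \<le> dist y (snd p) + dist y yb" by (metis dist_commute dist_triangle2)
  also have "\<dots> \<le> 2 * dist y yb" using min[OF zQ] by simp
  finally have "L * dist (snd p) yb \<le> L * (2 * dist y yb)" using L by (intro mult_left_mono) auto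
  then have lt: "dist p ?z < \<delta>" using est[OF pO] y by (simp add: algebra_simps)
  have "snd p = y"
  proof (rule ccontr)
    assume "snd p \<noteq> y"
    define d where "d = norm (y - snd p)"
    have d: "d > 0" using \<open>snd p \<noteq> y\<close> by (simp add: d_def)
    define v where "v = (y - snd p) /\<^sub>R d"
    have v: "norm v = 1" "y - snd p = d *\<^sub>R v" using d by (auto simp: v_def d_def)
    define M where "M = B + 1 + 1/2"
    have M: "M > 0" using B by (simp add: M_def)
    obtain t where t: "0 < t" "t < min (min d \<delta>) ((\<delta> - dist p ?z) / M)"
      using dense[of 0 "min (min d \<delta>) ((\<delta> - dist p ?z) / M)"] d \<delta> lt M by auto
    obtain q where q: "q \<in> \<Omega>" "dist (C v, v) ((q - p) /\<^sub>R t) < 1/2"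
      using move[OF v(1) pO t(1)] t(2) by auto
    have "norm (C v, v) \<le> B + 1"
      using norm_Pair_le[of "C v" v] C[of v] v(1) by simp
    then have "t * (norm (C v, v) + 1/2) \<le> t * M" using t(1) by (simp add: M_def)
    also have "\<dots> < \<delta> - dist p ?z" using t M by (simp add: field_simps)
    finally have "dist q p < \<delta> - dist p ?z" using dist_le_of_quotient[OF q(2) t(1)] by simp
    then have "q \<in> ?Q" using q(1) dist_triangle[of q ?z p] by (simp add: dist_commute)
    from min[OF this] have "d \<le> dist y (snd q)" by (simp add: d_def dist_norm)
    have "norm (snd ((C v, v) - (q - p) /\<^sub>R t)) \<le> norm ((C v, v) - (q - p) /\<^sub>R t)"
      by (metis norm_snd_le prod.collapse)
    then have "norm (v - (snd q - snd p) /\<^sub>R t) < 1/2"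
      using q(2) by (simp add: dist_norm)
    then have "t * norm (v - (snd q - snd p) /\<^sub>R t) < t * (1/2)" using t(1) by simp
    moreover have "t * norm (v - (snd q - snd p) /\<^sub>R t) = norm (t *\<^sub>R (v - (snd q - snd p) /\<^sub>R t))"
      using t(1) by simp
    moreover have "t *\<^sub>R (v - (snd q - snd p) /\<^sub>R t) = t *\<^sub>R v - (snd q - snd p)"
      using t(1) by (simp add: scaleR_diff_right)
    ultimately have less: "norm (t *\<^sub>R v - (snd q - snd p)) < t / 2" by simp
    have "y - snd q = (d - t) *\<^sub>R v + (t *\<^sub>R v - (snd q - snd p))"
      using v(2) by (simp add: algebra_simps)
    then have "norm (y - snd q) \<le> norm ((d - t) *\<^sub>R v) + norm (t *\<^sub>R v - (snd q - snd p))"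
      by (metis norm_triangle_ineq)
    also have "\<dots> < (d - t) + t / 2" using less t v(1) by simp
    also have "\<dots> < d" using t by simp
    finally show False using \<open>d \<le> dist y (snd q)\<close> by (simp add: dist_norm)
  qed
  then have "(fst p, y) = p" by (metis prod.collapse)
  with that[of "fst p"] pO est show thesis by (metis snd_conv)
qed

text \<open>If the tangent space is the graph of \<open>C\<close> over the second factor, then \<open>G (x, y) = x - C y\<close>
  vanishes on it and is therefore small on secants. With constant \<open>1/2\<close> this bounds secants by their
  second components, which gives uniqueness and a Lipschitz bound for \<open>h\<close>; with small constants it
  says that \<open>C\<close> is the strict derivative of \<open>h\<close>. Existence of \<open>h y\<close> is the covering property.\<close>

lemma strictly_smooth_localization:
  fixes \<Omega> :: "('a::euclidean_space \<times> 'b::euclidean_space) set" and C :: "'b \<Rightarrow> 'a"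
  assumes sm: "strictly_smooth_at \<Omega> (xb, yb)" and z: "(xb, yb) \<in> \<Omega>"
    and lc: "locally_closed_at \<Omega> (xb, yb)"
    and C: "bounded_linear C" and K: "tangent_cone \<Omega> (xb, yb) = range (\<lambda>v. (C v, v))"
  obtains U V L h where "open V" "yb \<in> V" "open U" "xb \<in> U" "h yb = xb"
    "\<Omega> \<inter> (U \<times> V) = {(h y, y) | y. y \<in> V}" "L-lipschitz_on V h"
    "\<And>e. e > 0 \<Longrightarrow> \<exists>\<delta>>0. \<forall>y y'. dist y yb < \<delta> \<longrightarrow> dist y' yb < \<delta> \<longrightarrow>
        norm (h y' - h y - C (y' - y)) \<le> e * norm (y' - y)"
proof -
  let ?z = "(xb, yb)"
  interpret C: bounded_linear C by fact
  obtain B where B: "B > 0" "\<And>v. norm (C v) \<le> norm v * B" using C.pos_bounded by blast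
  \<comment> \<open>For a secant \<open>(a, b)\<close> with \<open>norm (a - C b) \<le> 1/2 * norm (a, b)\<close> absorption of \<open>1/2 * norm a\<close>
    gives \<open>norm a \<le> (2 * B + 1) * norm b\<close>, hence \<open>norm (a, b) \<le> (2 * B + 2) * norm b\<close>.\<close>
  define L where "L = 2 * B + 2"
  have L: "L \<ge> 1" "L > 0" using B by (auto simp: L_def)
  define G where "G p = fst p - C (snd p)" for p :: "'a \<times> 'b"
  have G: "bounded_linear G"
    unfolding G_def by (intro bounded_linear_sub bounded_linear_fst bounded_linear_compose[OF C bounded_linear_snd])
  have van: "G w = 0" if "w \<in> tangent_cone \<Omega> ?z" for w
    using that unfolding K by (auto simp: G_def)
  note small = strictly_smooth_annihilator_small[OF sm z G van]
  obtain d1 where d1: "d1 > 0" "\<And>p q. p \<in> \<Omega> \<Longrightarrow> q \<in> \<Omega> \<Longrightarrow> dist p ?z < d1 \<Longrightarrow> dist q ?z < d1 \<Longrightarrow>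
      norm (G (q - p)) \<le> 1/2 * norm (q - p)"
    using small[of "1/2"] by auto
  have est: "norm (q - p) \<le> L * norm (snd q - snd p)"
    if "p \<in> \<Omega>" "q \<in> \<Omega>" "dist p ?z < d1" "dist q ?z < d1" for p q
  proof -
    define a where "a = fst (q - p)"
    define b where "b = snd (q - p)"
    have ab: "norm (q - p) \<le> norm a + norm b"
      unfolding a_def b_def by (metis norm_Pair_le prod.collapse)
    have "norm (a - C b) \<le> 1/2 * norm (q - p)"
      using d1(2)[OF that] by (simp add: G_def a_def b_def)
    moreover have "norm a \<le> norm (a - C b) + norm (C b)"
      by (metis norm_triangle_sub add.commute)
    ultimately have "norm (q - p) \<le> L * norm b"
      using ab B(2)[of b] by (simp add: L_def algebra_simps)
    then show ?thesis by (simp add: b_def)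
  qed
  have "compact ((\<lambda>v. (C v, v)) ` sphere 0 1)"
    by (intro compact_continuous_image compact_sphere continuous_intros C.continuous_on)
  from strictly_smooth_tangents_uniform[OF sm z this, of "1/2"]
  obtain d2 where d2: "d2 > 0" "\<And>v p t. norm v = 1 \<Longrightarrow> p \<in> \<Omega> \<Longrightarrow> dist p ?z < d2 \<Longrightarrow> 0 < t \<Longrightarrow> t < d2 \<Longrightarrow>
      \<exists>q\<in>\<Omega>. dist (C v, v) ((q - p) /\<^sub>R t) < 1/2"
    unfolding K by force
  obtain V0 where V0: "?z \<in> interior V0" "closed (\<Omega> \<inter> V0)"
    using lc unfolding locally_closed_at_def by blast
  obtain d3 where d3: "d3 > 0" "cball ?z d3 \<subseteq> V0"
    using V0(1) by (meson mem_interior_cball)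
  define d where "d = min (min d1 d2) d3 / 2"
  have d: "d > 0" "d < d1" "d < d2" "d < d3" using d1 d2 d3 by (auto simp: d_def)
  have "\<Omega> \<inter> cball ?z d = (\<Omega> \<inter> V0) \<inter> cball ?z d" using d3 d(4) by auto
  then have cpt: "compact (\<Omega> \<inter> cball ?z d)"
    using closed_Int_compact[OF V0(2) compact_cball] by simp
  \<comment> \<open>This radius puts \<open>(h y, y)\<close> within \<open>d / 2\<close> of the reference point.\<close>
  define r where "r = d / (2 * L)"
  have r: "r > 0" "r \<le> d / 2" using d L by (auto simp: r_def field_simps)
  have cover: "\<exists>x. (x, y) \<in> \<Omega> \<and> dist (x, y) ?z \<le> L * dist y yb" if y: "dist y yb < r" for y
  proof -
    have y': "2 * L * dist y yb < d" using y L by (simp add: r_def field_simps)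
    show ?thesis
    proof (rule strictly_smooth_covers[OF z cpt B(2) L(2) _ _ y'])
      fix p assume "p \<in> \<Omega>" "dist p ?z \<le> d"
      then show "dist p ?z \<le> L * dist (snd p) yb"
        using est[OF z, of p] d d1(1) by (simp add: dist_norm)
    next
      fix v p t assume "norm (v :: 'b) = 1" "p \<in> \<Omega>" "dist p ?z \<le> d" "0 < t" "t < d"
      then show "\<exists>q\<in>\<Omega>. dist (C v, v) ((q - p) /\<^sub>R t) < 1/2"
        using d2(2) d(3) by simp
    qed blast
  qed
  then obtain h where h: "\<And>y. dist y yb < r \<Longrightarrow> (h y, y) \<in> \<Omega>"
      "\<And>y. dist y yb < r \<Longrightarrow> dist (h y, y) ?z \<le> L * dist y yb"
    by metis
  have near: "dist (h y, y) ?z < d / 2" if "dist y yb < r" for y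
  proof -
    have "L * dist y yb < d / 2" using that L by (simp add: r_def field_simps)
    with h(2)[OF that] show ?thesis by simp
  qed
  have hyb: "h yb = xb" using h(2)[of yb] r by simp
  let ?U = "ball xb (d / 2)" and ?V = "ball yb r"
  have diff: "norm ((h y', y') - (h y, y)) \<le> L * norm (y' - y)"
    if "dist y yb < r" "dist y' yb < r" for y y'
    using est[OF h(1)[OF that(1)] h(1)[OF that(2)]] near[OF that(1)] near[OF that(2)] d by simp
  have "\<Omega> \<inter> (?U \<times> ?V) = {(h y, y) | y. y \<in> ?V}"
  proof (intro equalityI subsetI)
    fix p assume "p \<in> \<Omega> \<inter> (?U \<times> ?V)"
    then obtain x y where p: "p = (x, y)" "(x, y) \<in> \<Omega>" "dist x xb < d / 2" "dist y yb < r"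
      by (auto simp: dist_commute)
    have "dist (x, y) ?z \<le> dist x xb + dist y yb"
      using norm_Pair_le[of "x - xb" "y - yb"] by (simp add: dist_norm)
    then have "dist (x, y) ?z < d1" using p r d by simp
    with est[OF p(2) h(1)[OF p(4)]] near[OF p(4)] d have "norm ((h y, y) - (x, y)) \<le> 0" by simp
    then show "p \<in> {(h y, y) | y. y \<in> ?V}" using p by (auto simp: dist_commute)
  next
    fix p assume "p \<in> {(h y, y) | y. y \<in> ?V}"
    then obtain y where p: "p = (h y, y)" "dist y yb < r" by (auto simp: dist_commute)
    have "dist (h y) xb \<le> dist (h y, y) ?z"
      using norm_fst_le[of "h y - xb" "y - yb"] by (simp add: dist_norm)
    then show "p \<in> \<Omega> \<inter> (?U \<times> ?V)" using p h(1)[OF p(2)] near[OF p(2)] by (simp add: dist_commute)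
  qed
  moreover have "L-lipschitz_on ?V h"
  proof (rule lipschitz_onI)
    fix y y' assume "y \<in> ?V" "y' \<in> ?V"
    then have "norm ((h y, y) - (h y', y')) \<le> L * norm (y - y')"
      by (intro diff) (auto simp: dist_commute)
    then show "dist (h y) (h y') \<le> L * dist y y'"
      using norm_fst_le[of "h y - h y'" "y - y'"] by (simp add: dist_norm)
  qed (use L in simp)
  moreover have "\<exists>\<delta>>0. \<forall>y y'. dist y yb < \<delta> \<longrightarrow> dist y' yb < \<delta> \<longrightarrow>
        norm (h y' - h y - C (y' - y)) \<le> e * norm (y' - y)" if e: "e > 0" for e
  proof -
    obtain d' where d': "d' > 0" "\<And>p q. p \<in> \<Omega> \<Longrightarrow> q \<in> \<Omega> \<Longrightarrow> dist p ?z < d' \<Longrightarrow> dist q ?z < d' \<Longrightarrow>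
        norm (G (q - p)) \<le> e / L * norm (q - p)"
      using small[of "e / L"] e L by auto
    have "norm (h y' - h y - C (y' - y)) \<le> e * norm (y' - y)"
      if "dist y yb < min r (d' / L)" "dist y' yb < min r (d' / L)" for y y'
    proof -
      have *: "dist (h y, y) ?z < d'" if "dist y yb < min r (d' / L)" for y
      proof -
        have "L * dist y yb < d'" using that L by (simp add: field_simps)
        with h(2)[of y] that show ?thesis by simp
      qed
      have "norm (G ((h y', y') - (h y, y))) \<le> e / L * norm ((h y', y') - (h y, y))"
        by (rule d'(2)) (use h(1) that * in auto)
      also have "\<dots> \<le> e / L * (L * norm (y' - y))"
        by (intro mult_left_mono diff) (use that e L in auto)
      finally show ?thesis using L by (simp add: G_def)
    qed
    then show ?thesis using d' L r by (intro exI[of _ "min r (d' / L)"]) auto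
  qed
  ultimately show thesis
    using that[of ?V ?U h L] hyb r d by simp
qed

section \<open>Regularity properties and the tangent space\<close>

lemma le_mult_edist_set:
  assumes "\<kappa> > 0" "\<And>c. c \<in> C \<Longrightarrow> a \<le> \<kappa> * dist x c"
  shows "ereal a \<le> ereal \<kappa> * edist_set x C"
proof -
  have "ereal (a / \<kappa>) \<le> edist_set x C"
    unfolding edist_set_def using assms by (intro INF_greatest) (simp add: field_simps)
  then have "ereal \<kappa> * ereal (a / \<kappa>) \<le> ereal \<kappa> * edist_set x C"
    using assms(1) by (intro ereal_mult_left_mono) auto
  then show ?thesis using assms(1) by simp
qed

lemma edist_set_le: "c \<in> C \<Longrightarrow> edist_set x C \<le> ereal (dist x c)"
  unfolding edist_set_def by (rule INF_lower)

text \<open>For \<open>x\<close> near \<open>xb\<close> the values of \<open>F x\<close> inside \<open>V\<close> are governed by the Lipschitz map \<open>h\<close>.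
  Values outside \<open>V\<close> have a distance from \<open>y\<close> that is bounded below, and the neighborhoods are chosen so
  small that this distance dominates \<open>dist x (h y)\<close>.\<close>

lemma metrically_regular_of_Lipschitz_localization:
  assumes V: "open V" "yb \<in> V" and U: "open U" "xb \<in> U" and h: "h yb = xb"
    and loc: "gph F \<inter> (U \<times> V) = {(h y, y) | y. y \<in> V}" and lip: "L-lipschitz_on V h"
  shows "metrically_regular F xb yb"
proof -
  have L: "L \<ge> 0" using lip by (rule lipschitz_on_nonneg)
  have inF: "y \<in> F (h y)" if "y \<in> V" for y
    using loc that by (auto simp: gph_def)
  have uniq: "x = h y" if "x \<in> U" "y \<in> V" "y \<in> F x" for x y
  proof -
    have "(x, y) \<in> gph F \<inter> (U \<times> V)" using that by (simp add: gph_def)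
    then show ?thesis unfolding loc by auto
  qed
  obtain \<rho> where \<rho>: "\<rho> > 0" "ball yb \<rho> \<subseteq> V" using V openE by blast
  define \<kappa> where "\<kappa> = L + 1"
  have \<kappa>: "\<kappa> > 0" "\<kappa> \<ge> 1" "\<kappa> \<ge> L" using L by (auto simp: \<kappa>_def)
  define s where "s = \<rho> / (4 * \<kappa>)"
  have s: "s > 0" "\<kappa> * s = \<rho> / 4" "s \<le> \<rho> / 4"
    using \<rho> \<kappa> by (auto simp: s_def field_simps)
  have "edist_set x (inv_map F y) \<le> ereal \<kappa> * edist_set y (F x)"
    if x: "x \<in> U \<inter> ball xb (\<rho> / 4)" and y: "y \<in> ball yb s" for x y
  proof -
    have "dist yb y < \<rho>" using y s(3) \<rho>(1) by simp
    then have yV: "y \<in> V" using \<rho>(2) by auto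
    have "dist (h y) xb \<le> L * dist y yb"
      using lipschitz_onD[OF lip yV V(2)] h by simp
    also have "\<dots> \<le> \<kappa> * s" using y \<kappa> L by (intro mult_mono) (auto simp: dist_commute)
    finally have "dist (h y) xb \<le> \<rho> / 4" using s by simp
    then have a: "dist x (h y) \<le> \<rho> / 2"
      using x dist_triangle2[of x "h y" xb] by (simp add: dist_commute)
    have "edist_set x (inv_map F y) \<le> ereal (dist x (h y))"
      by (rule edist_set_le) (simp add: inv_map_def inF yV)
    also have "\<dots> \<le> ereal \<kappa> * edist_set y (F x)"
    proof (rule le_mult_edist_set[OF \<kappa>(1)])
      fix y' assume y': "y' \<in> F x"
      show "dist x (h y) \<le> \<kappa> * dist y y'"
      proof (cases "y' \<in> V")
        case True
        then have "x = h y'" using uniq x y' by blast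
        then have "dist x (h y) \<le> L * dist y y'"
          using lipschitz_onD[OF lip True yV] by (simp add: dist_commute)
        also have "\<dots> \<le> \<kappa> * dist y y'" using \<kappa> by (intro mult_right_mono) auto
        finally show ?thesis .
      next
        case False
        then have "\<rho> \<le> dist yb y'" using \<rho> by (auto simp: subset_iff not_less)
        moreover have "dist yb y < \<rho> / 4" using y s by simp
        ultimately have "\<rho> / 2 \<le> dist y y'" using dist_triangle[of yb y' y] \<rho> by simp
        also have "\<dots> \<le> \<kappa> * dist y y'" using \<kappa> mult_right_mono[of 1 \<kappa> "dist y y'"] by simp
        finally show ?thesis using a by simp
      qed
    qed
    finally show ?thesis .
  qed
  then show ?thesis
    unfolding metrically_regular_def
    using U \<rho> s \<kappa> by (intro exI[of _ \<kappa>] conjI exI[of _ "U \<inter> ball xb (\<rho> / 4)"] exI[of _ "ball yb s"]) auto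
qed

lemma metrically_regular_preimage_near:
  assumes mr: "metrically_regular F xb yb" and yb: "yb \<in> F xb"
  obtains \<kappa> \<rho> where "\<kappa> \<ge> 0" "\<rho> > 0"
    "\<And>y s. dist y yb < \<rho> \<Longrightarrow> \<kappa> * dist y yb < s \<Longrightarrow> \<exists>x. y \<in> F x \<and> dist xb x < s"
proof -
  obtain \<kappa> U V where *: "\<kappa> \<ge> 0" "xb \<in> U" "open V" "yb \<in> V"
    "\<forall>x\<in>U. \<forall>y\<in>V. edist_set x (inv_map F y) \<le> ereal \<kappa> * edist_set y (F x)"
    using mr unfolding metrically_regular_def by blast
  obtain \<rho> where \<rho>: "\<rho> > 0" "ball yb \<rho> \<subseteq> V" using *(3,4) openE by blast
  have "\<exists>x. y \<in> F x \<and> dist xb x < s" if y: "dist y yb < \<rho>" "\<kappa> * dist y yb < s" for y s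
  proof -
    have "y \<in> V" using y \<rho> by (auto simp: dist_commute)
    then have "edist_set xb (inv_map F y) \<le> ereal \<kappa> * edist_set y (F xb)" using * by blast
    also have "\<dots> \<le> ereal \<kappa> * ereal (dist y yb)"
      using *(1) yb by (intro ereal_mult_left_mono edist_set_le) auto
    also have "\<dots> < ereal s" using y by simp
    finally show ?thesis by (auto simp: edist_set_less_iff inv_map_def)
  qed
  then show thesis using that *(1) \<rho>(1) by blast
qed

text \<open>Metric regularity yields a preimage of \<open>y\<close> at distance about \<open>\<kappa> * dist y yb\<close> from \<open>xb\<close>, and
  the localization identifies it with any preimage \<open>x\<close> in the neighborhood \<open>U\<close>.\<close>

lemma strongly_metrically_regular_imp_subregular:
  assumes yb: "yb \<in> F xb" and smr: "strongly_metrically_regular F xb yb"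
  shows "strongly_metrically_subregular F xb yb"
proof -
  obtain h U V where V: "open V" "yb \<in> V" and U: "open U" "xb \<in> U"
    and loc: "gph F \<inter> (U \<times> V) = {(h y, y) | y. y \<in> V}"
    using smr unfolding strongly_metrically_regular_def inverse_localization_def by blast
  have uniq: "x = h y" if "x \<in> U" "y \<in> V" "y \<in> F x" for x y
  proof -
    have "(x, y) \<in> gph F \<inter> (U \<times> V)" using that by (simp add: gph_def)
    then show ?thesis unfolding loc by auto
  qed
  have mr: "metrically_regular F xb yb" using smr by (simp add: strongly_metrically_regular_def)
  obtain \<kappa> \<rho> where \<kappa>: "\<kappa> \<ge> 0" and \<rho>: "\<rho> > 0"
    and near: "\<And>y s. dist y yb < \<rho> \<Longrightarrow> \<kappa> * dist y yb < s \<Longrightarrow> \<exists>x. y \<in> F x \<and> dist xb x < s"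
    by (rule metrically_regular_preimage_near[OF mr yb]) blast
  obtain r where r: "r > 0" "ball xb r \<subseteq> U" using U openE by blast
  obtain \<rho>' where \<rho>': "\<rho>' > 0" "ball yb \<rho>' \<subseteq> V" using V openE by blast
  define \<eta> where "\<eta> = min (min \<rho> \<rho>') (r / (\<kappa> + 1))"
  have \<eta>: "\<eta> > 0" "\<eta> \<le> \<rho>" "\<eta> \<le> \<rho>'" "\<eta> \<le> r / (\<kappa> + 1)"
    using \<rho> \<rho>' r \<kappa> by (auto simp: \<eta>_def)
  from \<eta>(4) have \<eta>r: "(\<kappa> + 1) * \<eta> \<le> r" using \<kappa> by (simp add: field_simps)
  have "ereal (norm (x - xb)) \<le> ereal (\<kappa> + 1) * edist_set yb (F x)" if x: "x \<in> U \<inter> ball xb \<eta>" for x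
  proof (rule le_mult_edist_set)
    fix y assume y: "y \<in> F x"
    show "norm (x - xb) \<le> (\<kappa> + 1) * dist yb y"
    proof (cases "dist yb y < \<eta>")
      case True
      have yV: "y \<in> V" using True \<eta> \<rho>' by auto
      have "dist xb x \<le> \<kappa> * dist y yb"
      \<comment> \<open>Preimages are available only at distances \<open>s\<close> strictly above \<open>\<kappa> * dist y yb\<close>; the bound \<open>s < r\<close>
        keeps them in \<open>U\<close>.\<close>
      proof (rule dense_ge_bounded)
        have "\<kappa> * dist y yb \<le> \<kappa> * \<eta>"
          using True \<kappa> by (intro mult_left_mono) (auto simp: dist_commute)
        then show "\<kappa> * dist y yb < r" using \<eta>(1) \<eta>r by (simp add: algebra_simps)
      next
        fix s assume s: "\<kappa> * dist y yb < s" "s < r"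
        obtain x' where x': "y \<in> F x'" "dist xb x' < s"
          using near[of y s] True \<eta> s by (auto simp: dist_commute)
        then have "x' \<in> U" using r s by auto
        then have "x' = x" using uniq[OF _ yV] x y x'(1) by blast
        then show "dist xb x \<le> s" using x' by simp
      qed
      also have "\<dots> \<le> (\<kappa> + 1) * dist yb y" by (simp add: dist_commute algebra_simps)
      finally show ?thesis by (simp add: dist_norm norm_minus_commute)
    next
      case False
      have "norm (x - xb) \<le> \<eta>" using x by (simp add: dist_norm norm_minus_commute)
      also have "\<dots> \<le> dist yb y" using False by simp
      also have "\<dots> \<le> (\<kappa> + 1) * dist yb y" using \<kappa> mult_right_mono[of 1 "\<kappa> + 1" "dist yb y"] by simp
      finally show ?thesis .
    qed
  qed (use \<kappa> in simp)
  then show ?thesis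
    unfolding strongly_metrically_subregular_def
    using U \<eta> \<kappa> by (intro exI[of _ "\<kappa> + 1"] conjI exI[of _ "U \<inter> ball xb \<eta>"]) auto
qed

text \<open>Strong metric subregularity is an estimate for graph points near the reference point; divided by
  the step length it passes to tangent vectors. In particular the only tangent vector \<open>(u, 0)\<close> is zero.\<close>

lemma strongly_metrically_subregular_tangent_bound:
  assumes sub: "strongly_metrically_subregular F xb yb"
  obtains \<kappa> where "\<And>u v. (u, v) \<in> tangent_cone (gph F) (xb, yb) \<Longrightarrow> norm u \<le> \<kappa> * norm v"
proof -
  obtain \<kappa> U where \<kappa>: "\<kappa> \<ge> 0" and U: "open U" "xb \<in> U"
    and bound: "\<And>x. x \<in> U \<Longrightarrow> ereal (norm (x - xb)) \<le> ereal \<kappa> * edist_set yb (F x)"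
    using sub unfolding strongly_metrically_subregular_def by blast
  have "norm u \<le> \<kappa> * norm v" if uv: "(u, v) \<in> tangent_cone (gph F) (xb, yb)" for u v
  proof -
    obtain t p where t: "\<And>k. 0 < t k" "t \<longlonglongrightarrow> 0" and p: "\<And>k. p k \<in> gph F"
      and lim: "(\<lambda>k. (p k - (xb, yb)) /\<^sub>R t k) \<longlonglongrightarrow> (u, v)"
      using uv unfolding mem_tangent_cone_sequential by blast
    have fst_lim: "(\<lambda>k. (fst (p k) - xb) /\<^sub>R t k) \<longlonglongrightarrow> u" and snd_lim: "(\<lambda>k. (snd (p k) - yb) /\<^sub>R t k) \<longlonglongrightarrow> v"
      using tendsto_fst[OF lim] tendsto_snd[OF lim] by simp_all
    have "(\<lambda>k. fst (p k)) \<longlonglongrightarrow> xb" by (rule tendsto_of_convergent_quotients[OF t fst_lim])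
    then have ev: "\<forall>\<^sub>F k in sequentially. fst (p k) \<in> U" using U by (rule topological_tendstoD)
    have step: "norm ((fst (p k) - xb) /\<^sub>R t k) \<le> \<kappa> * norm ((snd (p k) - yb) /\<^sub>R t k)" if "fst (p k) \<in> U" for k
    proof -
      have "ereal (norm (fst (p k) - xb)) \<le> ereal \<kappa> * edist_set yb (F (fst (p k)))" by (rule bound[OF that])
      also have "\<dots> \<le> ereal \<kappa> * ereal (dist yb (snd (p k)))"
        using \<kappa> p[of k] by (intro ereal_mult_left_mono edist_set_le) (auto simp: gph_def case_prod_beta)
      finally have "norm (fst (p k) - xb) \<le> \<kappa> * norm (snd (p k) - yb)"
        by (simp add: dist_norm norm_minus_commute)
      then have "inverse (t k) * norm (fst (p k) - xb) \<le> inverse (t k) * (\<kappa> * norm (snd (p k) - yb))"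
        using t(1)[of k] by (intro mult_left_mono) auto
      moreover have "norm ((fst (p k) - xb) /\<^sub>R t k) = inverse (t k) * norm (fst (p k) - xb)"
        and "norm ((snd (p k) - yb) /\<^sub>R t k) = inverse (t k) * norm (snd (p k) - yb)"
        using t(1)[of k] by simp_all
      ultimately show ?thesis by (simp only: mult.left_commute)
    qed
    show ?thesis
      by (rule tendsto_le[OF _ tendsto_mult[OF tendsto_const tendsto_norm[OF snd_lim]] tendsto_norm[OF fst_lim]])
        (use ev step in \<open>auto elim: eventually_mono\<close>)
  qed
  then show thesis using that by blast
qed

text \<open>Metric regularity at \<open>xb\<close> lifts the segment \<open>yb + t *\<^sub>R v\<close> to graph points with bounded
  difference quotients, so every direction \<open>v\<close> is the second component of a tangent vector.\<close>

lemma metrically_regular_tangent_onto: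
  fixes F :: "'a::euclidean_space \<Rightarrow> 'b::euclidean_space set"
  assumes mr: "metrically_regular F xb yb" and yb: "yb \<in> F xb"
  shows "snd ` tangent_cone (gph F) (xb, yb) = UNIV"
proof -
  obtain \<kappa> \<rho> where \<kappa>: "\<kappa> \<ge> 0" and \<rho>: "\<rho> > 0"
    and near: "\<And>y s. dist y yb < \<rho> \<Longrightarrow> \<kappa> * dist y yb < s \<Longrightarrow> \<exists>x. y \<in> F x \<and> dist xb x < s"
    by (rule metrically_regular_preimage_near[OF mr yb]) blast
  have "v \<in> snd ` tangent_cone (gph F) (xb, yb)" for v
  proof -
    have nv: "norm v + 1 > 0" by (simp add: add_nonneg_pos)
    then have "\<rho> / (norm v + 1) > 0" using \<rho> by simp
    then obtain t where t: "\<And>k. 0 < t k" "\<And>k. t k < \<rho> / (norm v + 1)" and t0: "t \<longlonglongrightarrow> 0"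
      using null_sequence_below by blast
    have tv: "t k * norm v < \<rho>" for k
    proof -
      have "t k * (norm v + 1) < \<rho>" using t(2)[of k] nv by (simp only: pos_less_divide_eq)
      then show ?thesis using t(1)[of k] by (simp add: distrib_left)
    qed
    have "\<exists>x. yb + t k *\<^sub>R v \<in> F x \<and> dist xb x < t k * (\<kappa> * norm v + 1)" for k
    proof (rule near)
      show "dist (yb + t k *\<^sub>R v) yb < \<rho>" using tv[of k] t(1)[of k] by (simp add: dist_norm)
      show "\<kappa> * dist (yb + t k *\<^sub>R v) yb < t k * (\<kappa> * norm v + 1)"
        using t(1)[of k] by (simp add: dist_norm algebra_simps)
    qed
    then obtain x where x: "\<And>k. yb + t k *\<^sub>R v \<in> F (x k)" "\<And>k. dist xb (x k) < t k * (\<kappa> * norm v + 1)"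
      by metis
    define p where "p k = (x k, yb + t k *\<^sub>R v)" for k
    have p: "p k \<in> gph F" for k using x by (simp add: p_def gph_def)
    have quot: "(p k - (xb, yb)) /\<^sub>R t k = ((x k - xb) /\<^sub>R t k, v)" for k
      using t(1)[of k] by (simp add: p_def)
    have bd: "norm ((p k - (xb, yb)) /\<^sub>R t k) \<le> (\<kappa> * norm v + 1) + norm v" for k
    proof -
      have "norm ((x k - xb) /\<^sub>R t k) = dist xb (x k) / t k"
        using t(1)[of k] by (simp add: dist_norm norm_minus_commute divide_inverse)
      also have "\<dots> \<le> \<kappa> * norm v + 1"
        using x(2)[of k] t(1)[of k] by (simp add: pos_divide_le_eq mult.commute)
      finally show ?thesis
        unfolding quot using norm_Pair_le[of "(x k - xb) /\<^sub>R t k" v] by simp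
    qed
    obtain w r where w: "w \<in> tangent_cone (gph F) (xb, yb)"
        and lim: "(\<lambda>k. (p (r k) - (xb, yb)) /\<^sub>R t (r k)) \<longlonglongrightarrow> w"
      by (rule tangent_of_bounded_quotients[OF t(1) t0 p bd])
    have "(\<lambda>k. v) \<longlonglongrightarrow> snd w" using tendsto_snd[OF lim] unfolding quot by simp
    then have "snd w = v" by (simp add: LIMSEQ_const_iff)
    with w show ?thesis by blast
  qed
  then show ?thesis by blast
qed

section \<open>The dimension of the tangent space\<close>

text \<open>Differentiable maps transport difference quotients with varying directions (Hadamard
  differentiability), hence tangent vectors.\<close>

lemma has_derivative_sequence:
  assumes d: "(g has_derivative g') (at x)"
    and t: "\<And>k. 0 < t k" "t \<longlonglongrightarrow> 0" and lim: "(\<lambda>k. (y k - x) /\<^sub>R t k) \<longlonglongrightarrow> w"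
  shows "(\<lambda>k. (g (y k) - g x) /\<^sub>R t k) \<longlonglongrightarrow> g' w"
proof -
  interpret g': bounded_linear g' using d by (rule has_derivative_bounded_linear)
  obtain M where M: "M > 0" "\<And>k. norm ((y k - x) /\<^sub>R t k) \<le> M"
    using convergent_imp_Bseq[OF convergentI[OF lim]] unfolding Bseq_def by blast
  have y_lim: "y \<longlonglongrightarrow> x" by (rule tendsto_of_convergent_quotients[OF t lim])
  have "(\<lambda>k. (g (y k) - g x) /\<^sub>R t k - g' ((y k - x) /\<^sub>R t k)) \<longlonglongrightarrow> 0"
  proof (rule tendstoI)
    fix e :: real assume "e > 0"
    define e' where "e' = e / (2 * M)"
    have "e' > 0" using \<open>e > 0\<close> M by (simp add: e'_def)
    then obtain \<delta> where \<delta>: "\<delta> > 0"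
        "\<And>y. norm (y - x) < \<delta> \<Longrightarrow> norm (g y - g x - g' (y - x)) \<le> e' * norm (y - x)"
      using d unfolding has_derivative_at_alt by blast
    have "\<forall>\<^sub>F k in sequentially. dist (y k) x < \<delta>" using y_lim \<delta>(1) by (rule tendstoD)
    then show "\<forall>\<^sub>F k in sequentially. dist ((g (y k) - g x) /\<^sub>R t k - g' ((y k - x) /\<^sub>R t k)) 0 < e"
    proof (rule eventually_mono)
      fix k assume "dist (y k) x < \<delta>"
      then have "norm (g (y k) - g x - g' (y k - x)) \<le> e' * norm (y k - x)"
        using \<delta>(2) by (simp add: dist_norm)
      then have "inverse (t k) * norm (g (y k) - g x - g' (y k - x)) \<le> inverse (t k) * (e' * norm (y k - x))"
        using t(1)[of k] by (intro mult_left_mono) auto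
      also have "\<dots> = e' * norm ((y k - x) /\<^sub>R t k)" using t(1)[of k] by simp
      also have "\<dots> \<le> e' * M" using \<open>e' > 0\<close> M(2) by (intro mult_left_mono) auto
      also have "\<dots> < e" using \<open>e > 0\<close> M(1) by (simp add: e'_def)
      also have "inverse (t k) * norm (g (y k) - g x - g' (y k - x))
          = norm ((g (y k) - g x - g' (y k - x)) /\<^sub>R t k)" using t(1)[of k] by simp
      also have "(g (y k) - g x - g' (y k - x)) /\<^sub>R t k = (g (y k) - g x) /\<^sub>R t k - g' ((y k - x) /\<^sub>R t k)"
        by (subst g'.scaleR) (simp only: scaleR_right_diff_distrib)
      finally show "dist ((g (y k) - g x) /\<^sub>R t k - g' ((y k - x) /\<^sub>R t k)) 0 < e" by simp
    qed
  qed
  from tendsto_add[OF this g'.tendsto[OF lim]] show ?thesis by simp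
qed

text \<open>The derivative of \<open>\<Phi>\<close> carries the tangent space of \<open>gph F\<close> to that of the graph of a Lipschitz
  map \<open>f\<close> of \<open>d\<close> variables. A tangent vector of such a graph with vanishing first component is zero, and
  every first component occurs because the quotients of \<open>f\<close> are bounded. When the tangent cone is a
  subspace, composing with the first projection thus gives a linear bijection onto \<open>\<real>\<^sup>d\<close>.\<close>

lemma dim_tangent_cone_graphically_Lipschitzian:
  fixes F :: "real^'n \<Rightarrow> (real^'m) set"
  assumes gl: "graphically_Lipschitzian TYPE('d::finite) TYPE('e::finite) F xb yb"
    and yb: "yb \<in> F xb" and sub: "subspace (tangent_cone (gph F) (xb, yb))"
  shows "dim (tangent_cone (gph F) (xb, yb)) = CARD('d)"
proof -
  let ?z = "(xb, yb)" and ?K = "tangent_cone (gph F) (xb, yb)"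
  obtain W and \<Phi> :: "(real^'n) \<times> (real^'m) \<Rightarrow> (real^'d) \<times> (real^'e)" and U f L
    where W: "open W" "?z \<in> W" and \<Phi>: "inj_on \<Phi> W" "open (\<Phi> ` W)" "C1_on W \<Phi>"
      and \<Psi>: "C1_on (\<Phi> ` W) (inv_into W \<Phi>)"
      and U: "open U" and lip: "L-lipschitz_on U f"
      and graph: "\<Phi> ` (gph F \<inter> W) = {(u, f u) | u. u \<in> U}"
    using gl unfolding graphically_Lipschitzian_def by blast
  define \<Psi> where "\<Psi> = inv_into W \<Phi>"
  have \<Psi>\<Phi>: "\<Psi> (\<Phi> p) = p" if "p \<in> W" for p
    using that \<Phi>(1) by (simp add: \<Psi>_def)
  have L: "L \<ge> 0" using lip by (rule lipschitz_on_nonneg)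
  have zF: "?z \<in> gph F" using yb by (simp add: gph_def)
  obtain ub where ub: "\<Phi> ?z = (ub, f ub)" "ub \<in> U"
    using zF W(2) graph by blast
  obtain A where A: "(\<Phi> has_derivative A) (at ?z)"
    using \<Phi>(3) W(2) unfolding C1_on_def by blast
  obtain B where B: "(\<Psi> has_derivative B) (at (\<Phi> ?z))"
    using \<Psi> W(2) unfolding C1_on_def \<Psi>_def by blast
  interpret A: bounded_linear A using A by (rule has_derivative_bounded_linear)
  interpret B: bounded_linear B using B by (rule has_derivative_bounded_linear)
  have BA: "B (A w) = w" for w
  proof -
    have "((\<Psi> \<circ> \<Phi>) has_derivative (B \<circ> A)) (at ?z)" using A B by (rule diff_chain_at)
    moreover have "((\<Psi> \<circ> \<Phi>) has_derivative id) (at ?z)"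
      by (rule has_derivative_transform_within_open[OF has_derivative_id W]) (simp add: \<Psi>\<Phi>)
    ultimately have "B \<circ> A = id" by (rule has_derivative_unique)
    then show ?thesis by (metis comp_apply id_apply)
  qed
  have AB: "A (B w) = w" for w
  proof -
    have "(\<Phi> has_derivative A) (at (\<Psi> (\<Phi> ?z)))" using A by (simp add: \<Psi>\<Phi> W(2))
    with B have "((\<Phi> \<circ> \<Psi>) has_derivative (A \<circ> B)) (at (\<Phi> ?z))" by (rule diff_chain_at)
    moreover have "((\<Phi> \<circ> \<Psi>) has_derivative id) (at (\<Phi> ?z))"
      by (rule has_derivative_transform_within_open[OF has_derivative_id \<Phi>(2)])
        (use W(2) in \<open>auto simp: \<Psi>\<Phi>\<close>)
    ultimately have "A \<circ> B = id" by (rule has_derivative_unique)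
    then show ?thesis by (metis comp_apply id_apply)
  qed
  have bound: "norm (snd (A w)) \<le> L * norm (fst (A w))" if w: "w \<in> ?K" for w
  proof -
    obtain t p where t: "\<And>k. 0 < t k" "t \<longlonglongrightarrow> 0" and p: "\<And>k. p k \<in> gph F"
      and lim: "(\<lambda>k. (p k - ?z) /\<^sub>R t k) \<longlonglongrightarrow> w"
      using w unfolding mem_tangent_cone_sequential by blast
    have "p \<longlonglongrightarrow> ?z" by (rule tendsto_of_convergent_quotients[OF t lim])
    then have ev: "\<forall>\<^sub>F k in sequentially. p k \<in> W" using W by (rule topological_tendstoD)
    have lim': "(\<lambda>k. (\<Phi> (p k) - \<Phi> ?z) /\<^sub>R t k) \<longlonglongrightarrow> A w"
      by (rule has_derivative_sequence[OF A t lim])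
    have step: "norm (snd ((\<Phi> (p k) - \<Phi> ?z) /\<^sub>R t k)) \<le> L * norm (fst ((\<Phi> (p k) - \<Phi> ?z) /\<^sub>R t k))"
      if "p k \<in> W" for k
    proof -
      have "\<Phi> (p k) \<in> \<Phi> ` (gph F \<inter> W)" using p[of k] that by simp
      then obtain u where u: "\<Phi> (p k) = (u, f u)" "u \<in> U"
        unfolding graph by blast
      have "norm (f u - f ub) \<le> L * norm (u - ub)"
        using lipschitz_onD[OF lip u(2) ub(2)] by (simp add: dist_norm)
      then have "inverse (t k) * norm (f u - f ub) \<le> inverse (t k) * (L * norm (u - ub))"
        using t(1)[of k] by (intro mult_left_mono) auto
      moreover have "norm ((f u - f ub) /\<^sub>R t k) = inverse (t k) * norm (f u - f ub)"
        and "norm ((u - ub) /\<^sub>R t k) = inverse (t k) * norm (u - ub)"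
        using t(1)[of k] by simp_all
      ultimately show ?thesis
        unfolding u(1) ub(1) diff_Pair scaleR_Pair fst_conv snd_conv by (simp only: mult.left_commute)
    qed
    have "\<forall>\<^sub>F k in sequentially. norm (snd ((\<Phi> (p k) - \<Phi> ?z) /\<^sub>R t k))
        \<le> L * norm (fst ((\<Phi> (p k) - \<Phi> ?z) /\<^sub>R t k))"
      by (rule eventually_mono[OF ev step])
    then show ?thesis
      by (rule tendsto_le[OF sequentially_bot tendsto_mult[OF tendsto_const tendsto_norm[OF tendsto_fst[OF lim']]]
          tendsto_norm[OF tendsto_snd[OF lim']]])
  qed
  have onto: "v \<in> (fst \<circ> A) ` ?K" for v
  proof -
    obtain \<rho> where \<rho>: "\<rho> > 0" "ball ub \<rho> \<subseteq> U" using U ub(2) openE by blast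
    have nv: "norm v + 1 > 0" by (simp add: add_nonneg_pos)
    then have "\<rho> / (norm v + 1) > 0" using \<rho>(1) by simp
    then obtain t where t: "\<And>k. 0 < t k" "\<And>k. t k < \<rho> / (norm v + 1)" and t0: "t \<longlonglongrightarrow> 0"
      using null_sequence_below by blast
    have tv: "t k * norm v < \<rho>" for k
    proof -
      have "t k * (norm v + 1) < \<rho>" using t(2)[of k] nv by (simp only: pos_less_divide_eq)
      then show ?thesis using t(1)[of k] by (simp add: distrib_left)
    qed
    define u where "u k = ub + t k *\<^sub>R v" for k
    have u: "u k \<in> U" for k
    proof -
      have "dist ub (u k) < \<rho>" using tv[of k] t(1)[of k] by (simp add: dist_norm u_def)
      then show ?thesis using \<rho>(2) by auto
    qed
    define q where "q k = (u k, f (u k))" for k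
    have q: "q k \<in> \<Phi> ` (gph F \<inter> W)" for k
      unfolding graph q_def using u by blast
    have quot: "(q k - \<Phi> ?z) /\<^sub>R t k = (v, (f (u k) - f ub) /\<^sub>R t k)" for k
      using t(1)[of k] by (simp add: q_def ub(1) u_def)
    have bd: "norm ((q k - \<Phi> ?z) /\<^sub>R t k) \<le> norm v + L * norm v" for k
    proof -
      have "norm (f (u k) - f ub) \<le> L * (t k * norm v)"
        using lipschitz_onD[OF lip u ub(2), of k] t(1)[of k] by (simp add: dist_norm u_def)
      then have "norm (f (u k) - f ub) / t k \<le> L * norm v"
        using t(1)[of k] by (simp add: pos_divide_le_eq mult_ac)
      moreover have "norm ((f (u k) - f ub) /\<^sub>R t k) = norm (f (u k) - f ub) / t k"
        using t(1)[of k] by (simp add: divide_inverse)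
      ultimately have "norm ((f (u k) - f ub) /\<^sub>R t k) \<le> L * norm v" by (simp only:)
      then show ?thesis
        unfolding quot using norm_Pair_le[of v "(f (u k) - f ub) /\<^sub>R t k"] by simp
    qed
    obtain w r where r: "strict_mono r" and lim: "(\<lambda>k. (q (r k) - \<Phi> ?z) /\<^sub>R t (r k)) \<longlonglongrightarrow> w"
      by (rule tangent_of_bounded_quotients[OF t(1) t0 q bd])
    have "(\<lambda>k. v) \<longlonglongrightarrow> fst w" using tendsto_fst[OF lim] unfolding quot by simp
    then have fst_w: "fst w = v" by (simp add: LIMSEQ_const_iff)
    have tr: "(\<lambda>k. t (r k)) \<longlonglongrightarrow> 0" using LIMSEQ_subseq_LIMSEQ[OF t0 r] by (simp add: o_def)
    have "(\<lambda>k. (\<Psi> (q (r k)) - \<Psi> (\<Phi> ?z)) /\<^sub>R t (r k)) \<longlonglongrightarrow> B w"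
      by (rule has_derivative_sequence[OF B t(1) tr lim])
    then have lim': "(\<lambda>k. (\<Psi> (q (r k)) - ?z) /\<^sub>R t (r k)) \<longlonglongrightarrow> B w"
      by (simp only: \<Psi>\<Phi>[OF W(2)])
    have "\<Psi> (q k) \<in> gph F" for k using q[of k] \<Psi>\<Phi> by auto
    with lim' tr t(1) have "B w \<in> ?K"
      unfolding mem_tangent_cone_sequential
      by (intro exI[of _ "\<lambda>k. t (r k)"] exI[of _ "\<lambda>k. \<Psi> (q (r k))"] conjI allI)
    moreover have "(fst \<circ> A) (B w) = v" by (simp add: AB fst_w)
    ultimately show ?thesis by (metis image_eqI)
  qed
  have lin: "linear (fst \<circ> A)"
    by (intro linear_compose A.linear linear_fst)
  have "inj_on (fst \<circ> A) ?K"
  proof (subst linear_inj_on_iff_eq_0[OF lin sub], intro ballI impI)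
    fix w assume w: "w \<in> ?K" "(fst \<circ> A) w = 0"
    then have "fst (A w) = 0" "snd (A w) = 0" using bound[OF w(1)] by auto
    then have "A w = 0" by (simp add: prod_eq_iff)
    then show "w = 0" using BA[of w] B.zero by simp
  qed
  then have "dim ((fst \<circ> A) ` ?K) = dim ?K"
    using dim_image_eq[OF lin, of ?K] span_eq_iff[THEN iffD2, OF sub] by simp
  moreover have "(fst \<circ> A) ` ?K = UNIV" using onto by blast
  ultimately show ?thesis by simp
qed

section \<open>Consequences of the localization\<close>

text \<open>Exchanging the two components turns the graph of the localization into a graph over \<open>y\<close>.\<close>

lemma graphically_Lipschitzian_of_localization:
  fixes F :: "real^'n \<Rightarrow> (real^'m) set"
  assumes V: "open V" "yb \<in> V" and U: "open U" "xb \<in> U"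
    and loc: "gph F \<inter> (U \<times> V) = {(h y, y) | y. y \<in> V}" and lip: "L-lipschitz_on V h"
  shows "graphically_Lipschitzian TYPE('m) TYPE('n) F xb yb"
proof -
  let ?W = "U \<times> V"
  let ?\<Phi> = "prod.swap :: (real^'n) \<times> (real^'m) \<Rightarrow> (real^'m) \<times> (real^'n)"
  have img: "?\<Phi> ` ?W = V \<times> U" by auto
  have C1: "C1_on S (prod.swap :: 'a \<times> 'b \<Rightarrow> 'b \<times> 'a)"
    for S :: "('a::real_normed_vector \<times> 'b::real_normed_vector) set"
    unfolding C1_on_def
  proof (intro exI conjI ballI)
    have bl: "bounded_linear (prod.swap :: 'a \<times> 'b \<Rightarrow> 'b \<times> 'a)"
      unfolding prod.swap_def by (intro bounded_linear_Pair bounded_linear_fst bounded_linear_snd)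
    show "(prod.swap has_derivative blinfun_apply (Blinfun (prod.swap :: 'a \<times> 'b \<Rightarrow> 'b \<times> 'a))) (at z)" for z
      using bl by (simp add: bounded_linear_Blinfun_apply bounded_linear_imp_has_derivative)
  qed (rule continuous_on_const)
  have inv: "inv_into ?W ?\<Phi> q = prod.swap q" if "q \<in> V \<times> U" for q
    using that by (intro inv_into_f_eq) auto
  have "C1_on (?\<Phi> ` ?W) (inv_into ?W ?\<Phi>)"
  proof -
    obtain f' where f': "\<forall>q\<in>V \<times> U. (prod.swap has_derivative blinfun_apply (f' q)) (at q)"
        "continuous_on (V \<times> U) f'"
      using C1[of "V \<times> U"] unfolding C1_on_def by blast
    have "(inv_into ?W ?\<Phi> has_derivative blinfun_apply (f' q)) (at q)" if "q \<in> V \<times> U" for q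
      by (rule has_derivative_transform_within_open[of prod.swap _ _ _ "V \<times> U"])
        (use f'(1) that V U inv in \<open>auto intro: open_Times\<close>)
    then show ?thesis unfolding C1_on_def img using f'(2) by blast
  qed
  moreover have "?\<Phi> ` (gph F \<inter> ?W) = {(y, h y) | y. y \<in> V}"
    unfolding loc by force
  moreover have "inj_on ?\<Phi> ?W" by (auto intro: inj_onI)
  ultimately show ?thesis
    unfolding graphically_Lipschitzian_def
    using V U C1[of ?W] lip img
    by (intro conjI exI[of _ ?W] exI[of _ ?\<Phi>] exI[of _ V] exI[of _ h] exI[of _ L])
      (auto simp: open_Times add.commute)
qed

lemma strictly_differentiable_atI:
  fixes A :: "real^'m^'n"
  assumes diff: "\<And>e. e > 0 \<Longrightarrow> \<exists>\<delta>>0. \<forall>y y'. dist y yb < \<delta> \<longrightarrow> dist y' yb < \<delta> \<longrightarrow>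
      norm (h y' - h y - A *v (y' - y)) \<le> e * norm (y' - y)"
  shows "strictly_differentiable_at h yb"
  unfolding strictly_differentiable_at_def Lim_within
proof (intro exI[of _ A] allI impI)
  fix e :: real assume "e > 0"
  then obtain \<delta> where \<delta>: "\<delta> > 0" "\<And>y y'. dist y yb < \<delta> \<Longrightarrow> dist y' yb < \<delta> \<Longrightarrow>
      norm (h y' - h y - A *v (y' - y)) \<le> e / 2 * norm (y' - y)"
    using diff[of "e / 2"] by auto
  have "dist ((h y' - h y - A *v (y' - y)) /\<^sub>R norm (y' - y)) 0 < e"
    if "y \<noteq> y'" "dist (y, y') (yb, yb) < \<delta>" for y y'
  proof -
    have "dist y yb < \<delta>" "dist y' yb < \<delta>"
      using that(2) norm_fst_le[of "y - yb" "y' - yb"] norm_snd_le[of "y' - yb" "y - yb"]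
      by (auto simp: dist_norm)
    from \<delta>(2)[OF this] have "norm (h y' - h y - A *v (y' - y)) / norm (y' - y) \<le> e / 2"
      using that(1) by (simp add: pos_divide_le_eq)
    moreover have "norm (a /\<^sub>R norm b) = norm a / norm b" for a :: "real^'n" and b :: "real^'m"
      by (simp add: divide_inverse)
    ultimately show ?thesis
      unfolding dist_norm diff_0_right using \<open>e > 0\<close> by (simp only:)
  qed
  then show "\<exists>d>0. \<forall>x\<in>{(y, y'). y \<noteq> y'}. 0 < dist x (yb, yb) \<and> dist x (yb, yb) < d \<longrightarrow>
      dist (case x of (y, y') \<Rightarrow> (h y' - h y - A *v (y' - y)) /\<^sub>R norm (y' - y)) 0 < e"
    using \<delta>(1) by (intro exI[of _ \<delta>]) auto
qed

section \<open>Graphs of linear maps and their orthogonal complements\<close>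

text \<open>A linear section of the projection has an image of the same dimension as \<open>K\<close> inside \<open>K\<close>.\<close>

lemma subspace_eq_rge:
  fixes K :: "((real^'n) \<times> (real^'m)) set"
  assumes K: "subspace K" and dim: "dim K = CARD('m)" and onto: "snd ` K = UNIV"
  obtains C :: "real^'m^'n" where "K = rge C (mat 1 :: real^'m^'m)"
proof -
  obtain g where g: "range g \<subseteq> K" "linear g" "\<And>v. snd (g v) = v"
    using linear_exists_right_inverse_on[OF linear_snd K] onto by auto
  have "inj g" using g(3) by (metis injI)
  then have "dim (range g) = CARD('m)"
    using dim_image_eq[OF g(2), of UNIV] by simp
  then have eq: "range g = K"
    by (intro subspace_dim_equal linear_subspace_image g K) (auto simp: dim)
  have lin: "linear (fst \<circ> g)" by (intro linear_compose g linear_fst)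
  have "matrix (fst \<circ> g) *v v = fst (g v)" for v
    using matrix_works[of "fst \<circ> g" v] lin by (simp add: linear_matrix_vector_mul_eq)
  then have "(matrix (fst \<circ> g) *v v, mat 1 *v v) = g v" for v
    by (simp add: prod_eq_iff g(3))
  then have "K = rge (matrix (fst \<circ> g)) (mat 1)"
    unfolding rge_def eq[symmetric] by auto
  then show thesis by (rule that)
qed

lemma gph_limiting_coderivative:
  fixes F :: "real^'n \<Rightarrow> (real^'m) set"
  assumes sm: "strictly_smooth_at (gph F) (xb, yb)" and z: "(xb, yb) \<in> gph F"
  shows "gph (limiting_coderivative F xb yb) =
    {(ys, xs). (xs, - ys) \<in> (tangent_cone (gph F) (xb, yb))\<^sup>\<bottom>}"
  unfolding gph_def[of "limiting_coderivative F xb yb"] limiting_coderivative_def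
    limiting_normal_cone_strictly_smooth[OF sm z] orthogonal_comp_def orthogonal_def
  by (auto simp: inner_commute)

lemma orthogonal_comp_rge:
  fixes C :: "real^'m^'n"
  shows "(rge C (mat 1 :: real^'m^'m))\<^sup>\<bottom> = {(x, - (transpose C *v x)) | x. True}"
proof -
  have "(\<forall>v. (C *v v) \<bullet> x + v \<bullet> y = 0) \<longleftrightarrow> y = - (transpose C *v x)" for x y
  proof -
    have "(C *v v) \<bullet> x + v \<bullet> y = v \<bullet> (transpose C *v x + y)" for v
      using dot_lmul_matrix[of x C v] by (simp add: inner_commute inner_add_right)
    then have "(\<forall>v. (C *v v) \<bullet> x + v \<bullet> y = 0) \<longleftrightarrow> transpose C *v x + y = 0"
      by (metis inner_eq_zero_iff inner_zero_right)
    then show ?thesis by (metis add_eq_0_iff)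
  qed
  then have "(\<forall>w\<in>rge C (mat 1 :: real^'m^'m). w \<bullet> (x, y) = 0) \<longleftrightarrow> y = - (transpose C *v x)" for x y
    by (simp add: rge_def Ball_def del: transpose_matrix_vector)
  then show ?thesis
    by (auto simp: orthogonal_comp_def orthogonal_def simp del: transpose_matrix_vector)
qed

text \<open>By the description of the normal cone, the graph of the coderivative is the orthogonal
  complement of the tangent space up to order and sign of the components. Since both subspaces equal
  their double complements, the two conditions on \<open>C\<close> express the same equality.\<close>

lemma coderivative_rge_iff:
  fixes F :: "real^'n \<Rightarrow> (real^'m) set" and C :: "real^'m^'n"
  assumes sm: "strictly_smooth_at (gph F) (xb, yb)" and z: "(xb, yb) \<in> gph F"
  shows "gph (limiting_coderivative F xb yb) = rge (transpose C) (mat 1 :: real^'n^'n) \<longleftrightarrow>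
    tangent_cone (gph F) (xb, yb) = rge C (mat 1 :: real^'m^'m)"
proof -
  let ?K = "tangent_cone (gph F) (xb, yb)" and ?R = "rge C (mat 1 :: real^'m^'m)"
  have K: "subspace ?K" by (rule subspace_tangent_cone[OF sm z])
  have "?R = range (\<lambda>v. (C *v v, v))" by (auto simp: rge_def)
  moreover have "linear (\<lambda>v. (C *v v, v))"
    by (auto intro!: linearI simp: matrix_vector_right_distrib matrix_vector_mult_scaleR)
  ultimately have R: "subspace ?R" by (simp add: linear_subspace_image)
  have "gph (limiting_coderivative F xb yb) = rge (transpose C) (mat 1 :: real^'n^'n) \<longleftrightarrow>
      {(ys, xs). (xs, - ys) \<in> ?K\<^sup>\<bottom>} = {(transpose C *v x, x) | x. True}"
    unfolding gph_limiting_coderivative[OF sm z] by (simp add: rge_def)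
  also have "\<dots> \<longleftrightarrow> ?K\<^sup>\<bottom> = ?R\<^sup>\<bottom>"
  proof -
    have R: "{(ys, xs). (xs, - ys) \<in> ?R\<^sup>\<bottom>} = {(transpose C *v x, x) | x. True}"
      unfolding orthogonal_comp_rge by auto
    have inj: "A = B" if "{(ys, xs). (xs, - ys) \<in> A} = {(ys, xs). (xs, - ys) \<in> B}"
      for A B :: "((real^'n) \<times> (real^'m)) set"
    proof -
      have "(x, - y) \<in> A \<longleftrightarrow> (x, - y) \<in> B" for x y
        using that by (auto simp: set_eq_iff)
      from this[of _ "- _"] show ?thesis by (auto simp: set_eq_iff)
    qed
    show ?thesis
      unfolding R[symmetric] by (rule iffI[OF inj]) simp_all
  qed
  also have "\<dots> \<longleftrightarrow> ?K = ?R"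
    using orthogonal_comp_self[OF K] orthogonal_comp_self[OF R] by metis
  finally show ?thesis .
qed

lemma gph_graphical_derivative:
  "gph (graphical_derivative F xb yb) = tangent_cone (gph F) (xb, yb)"
  by (auto simp: gph_def graphical_derivative_def)

section \<open>The equivalence\<close>

theorem theorem3p6:
  fixes F :: "real^'n \<Rightarrow> (real^'m) set"
    and xb :: "real^'n" and yb :: "real^'m"
  assumes "yb \<in> F xb"
    and "strictly_proto_differentiable F xb yb"
    and "locally_closed_at (gph F) (xb, yb)"
  defines "stmt_i \<equiv> strongly_metrically_regular F xb yb"
    and "stmt_ii \<equiv> graphically_Lipschitzian TYPE('m) TYPE('n) F xb yb \<and>
                    metrically_regular F xb yb"
    and "stmt_iii \<equiv> graphically_Lipschitzian TYPE('m) TYPE('n) F xb yb \<and>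
                     strongly_metrically_subregular F xb yb"
    and "stmt_iv \<equiv> \<exists>C :: real^'m^'n.
                     gph (limiting_coderivative F xb yb) = rge (transpose C) (mat 1 :: real^'n^'n)"
    and "stmt_v \<equiv> \<exists>C :: real^'m^'n.
                    gph (graphical_derivative F xb yb) = rge C (mat 1 :: real^'m^'m)"
  shows "(stmt_i \<longleftrightarrow> stmt_ii) \<and> (stmt_i \<longleftrightarrow> stmt_iii) \<and> (stmt_i \<longleftrightarrow> stmt_iv) \<and> (stmt_i \<longleftrightarrow> stmt_v) \<and>
    (stmt_i \<or> stmt_ii \<or> stmt_iii \<or> stmt_iv \<or> stmt_v \<longrightarrow>
      (\<exists>h. inverse_localization F xb yb h \<and> strictly_differentiable_at h yb))"
proof -
  let ?K = "tangent_cone (gph F) (xb, yb)"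
  have z: "(xb, yb) \<in> gph F" using assms(1) by (simp add: gph_def)
  have sm: "strictly_smooth_at (gph F) (xb, yb)"
    using assms(2) by (simp add: strictly_proto_differentiable_def)
  have K: "subspace ?K" by (rule subspace_tangent_cone[OF sm z])
  have v_iff: "stmt_v \<longleftrightarrow> (\<exists>C :: real^'m^'n. ?K = rge C (mat 1 :: real^'m^'m))"
    by (simp add: stmt_v_def gph_graphical_derivative)
  have inj: "inj_on snd ?K" if "strongly_metrically_subregular F xb yb"
  proof -
    obtain \<kappa> where \<kappa>: "\<And>u v. (u, v) \<in> ?K \<Longrightarrow> norm u \<le> \<kappa> * norm v"
      by (rule strongly_metrically_subregular_tangent_bound[OF \<open>strongly_metrically_subregular F xb yb\<close>]) blast
    show ?thesis
    proof (subst linear_inj_on_iff_eq_0[OF linear_snd K], intro ballI impI)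
      fix w assume w: "w \<in> ?K" "snd w = 0"
      have "(fst w, snd w) \<in> ?K" using w(1) by (simp only: prod.collapse)
      from \<kappa>[OF this] w(2) have "fst w = 0" by simp
      with w(2) show "w = 0" by (simp add: prod_eq_iff)
    qed
  qed
  have dim_snd: "dim (snd ` ?K) = dim ?K" if "inj_on snd ?K"
    using that dim_image_eq[OF linear_snd, of ?K] span_eq_iff[THEN iffD2, OF K] by simp
  have i_sub: "strongly_metrically_subregular F xb yb" if stmt_i
    using that unfolding stmt_i_def
    by (rule strongly_metrically_regular_imp_subregular[of yb F xb, OF assms(1)])
  have i_v: stmt_v if stmt_i
  proof -
    have "snd ` ?K = UNIV"
      using that assms(1) unfolding stmt_i_def strongly_metrically_regular_def
      by (intro metrically_regular_tangent_onto) auto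
    moreover have "dim ?K = CARD('m)"
      using dim_snd[OF inj[OF i_sub[OF that]]] \<open>snd ` ?K = UNIV\<close> by simp
    ultimately show stmt_v unfolding v_iff using subspace_eq_rge[OF K] by metis
  qed
  have ii_v: stmt_v if stmt_ii
  proof -
    have "snd ` ?K = UNIV"
      using that assms(1) unfolding stmt_ii_def
      by (intro metrically_regular_tangent_onto) auto
    moreover have "dim ?K = CARD('m)"
      using that assms(1) K unfolding stmt_ii_def
      by (intro dim_tangent_cone_graphically_Lipschitzian) auto
    ultimately show stmt_v unfolding v_iff using subspace_eq_rge[OF K] by metis
  qed
  have iii_v: stmt_v if stmt_iii
  proof -
    have dim: "dim ?K = CARD('m)"
      using that assms(1) K unfolding stmt_iii_def
      by (intro dim_tangent_cone_graphically_Lipschitzian) auto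
    have "dim (snd ` ?K) = CARD('m)"
      using dim_snd[OF inj] that dim unfolding stmt_iii_def by simp
    then have "snd ` ?K = UNIV"
      by (intro subspace_dim_equal linear_subspace_image[OF linear_snd K]) auto
    with dim show stmt_v unfolding v_iff using subspace_eq_rge[OF K] by metis
  qed
  have iv_v: "stmt_iv \<longleftrightarrow> stmt_v"
    unfolding v_iff by (simp add: stmt_iv_def coderivative_rge_iff[OF sm z] del: transpose_matrix_vector)
  have v_all: "stmt_i \<and> stmt_ii \<and> stmt_iii \<and>
      (\<exists>h. inverse_localization F xb yb h \<and> strictly_differentiable_at h yb)" if stmt_v
  proof -
    obtain C :: "real^'m^'n" where C: "?K = rge C (mat 1 :: real^'m^'m)"
      using \<open>stmt_v\<close> unfolding v_iff by blast
    then have range: "?K = range (\<lambda>v. (C *v v, v))" by (auto simp: rge_def)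
    obtain U V L h where V: "open V" "yb \<in> V" and U: "open U" "xb \<in> U" and h: "h yb = xb"
      and loc: "gph F \<inter> (U \<times> V) = {(h y, y) | y. y \<in> V}" and lip: "L-lipschitz_on V h"
      and diff: "\<And>e. e > 0 \<Longrightarrow> \<exists>\<delta>>0. \<forall>y y'. dist y yb < \<delta> \<longrightarrow> dist y' yb < \<delta> \<longrightarrow>
          norm (h y' - h y - C *v (y' - y)) \<le> e * norm (y' - y)"
      by (rule strictly_smooth_localization[OF sm z assms(3) matrix_vector_mul_bounded_linear range]) blast
    have mr: "metrically_regular F xb yb"
      by (rule metrically_regular_of_Lipschitz_localization[OF V U h loc lip])
    have il: "inverse_localization F xb yb h"
      unfolding inverse_localization_def using V U h loc by blast
    have i: stmt_i using mr il by (auto simp: stmt_i_def strongly_metrically_regular_def)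
    have gl: "graphically_Lipschitzian TYPE('m) TYPE('n) F xb yb"
      by (rule graphically_Lipschitzian_of_localization[OF V U loc lip])
    have "strictly_differentiable_at h yb"
      by (rule strictly_differentiable_atI[OF diff])
    then show ?thesis
      using i gl mr il i_sub[OF i] unfolding stmt_ii_def stmt_iii_def by blast
  qed
  show ?thesis using i_v ii_v iii_v iv_v v_all by blast
qed

end
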